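(* Let $\mathbb{A}=\langle A;\wedge,\vee,\neg,0,1,\Diamond\rangle$ be a modal algebra. The following are equivalent: (1) the profinite completion $(\mu,\hat{\mathbb{A}})$ is (isomorphic, as a completion, to) the MacNeille completion of $\mathbb{A}$, and $\Diamond$ is smooth; (2) $\mathbb{A}$ is residually finite and for every $\theta\in\Phi_{\mathbb{A}}$, the congruence class $1/\theta$ is a principal lattice filter of $\mathbb{A}$ (i.e. $1/\theta = \{b\in A\mid b\ge a\}$ for some $a\in A$).
   Context: A modal algebra is a Boolean algebra with a unary operation $\Diamond$ satisfying $\Diamond 0=0$ and $\Diamond(a\vee b)=\Diamond a\vee\Diamond b$. $\Phi_{\mathbb{A}}$ denotes the set of (modal algebra) congruences $\theta$ of $\mathbb{A}$ with $\mathbb{A}/\theta$ finite; $\mathbb{A}$ is residually finite if for all $a\ne b$ in $A$ there is $\theta\in\Phi_{\mathbb{A}}$ with $a/\theta\ne b/\theta$. The profinite completion is $\hat{\mathbb{A}}=\{\alpha\in\prod_{\theta\in\Phi_{\mathbb{A}}}\mathbb{A}/\theta\mid$ for all $\theta\subseteq\psi$ in $\Phi_{\mathbb{A}}$, if $\alpha(\theta)=a/\theta$ then $\alpha(\psi)=a/\psi\}$ with coordinatewise operations, and $\mu\colon\mathbb{A}\to\hat{\mathbb{A}}$, $\mu(a)=(a/\theta)_{\theta\in\Phi_{\mathbb{A}}}$. A completion of a lattice $\mathbb{B}$ is a pair $(m,\mathbb{C})$ with $m\colon\mathbb{B}\hookrightarrow\mathbb{C}$ a lattice embedding into a complete lattice;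 two completions $(m,\mathbb{C}),(k,\mathbb{D})$ are isomorphic if $g m=k$ for some lattice isomorphism $g\colon\mathbb{C}\to\mathbb{D}$. The MacNeille completion $\bar{\mathbb{B}}$ of a Boolean algebra $\mathbb{B}$ is (up to isomorphism) the completion $(m,\mathbb{C})$ with $m[B]$ join-dense in $\mathbb{C}$ (every element of $C$ is the join of the elements of $m[B]$ below it). For an order-preserving map $f\colon\mathbb{B}\to\mathbb{B}$ of a Boolean algebra with MacNeille completion $(m,\bar{\mathbb{B}})$, the lower extension is $f^{\circ}\colon\bar{\mathbb{B}}\to\bar{\mathbb{B}}$, $f^\circ(x)=\bigvee\{m(f(a))\mid m(a)\le x\}$, and the upper extension is $f^{\bullet}(x)=\bigwedge\{m(f(a))\mid x\le m(a)\}$; $f$ is smooth if $f^\circ=f^\bullet$. *)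

theory Defs
  imports "HOL-Algebra.Complete_Lattice" "HOL-Library.FuncSet"
begin

text \<open>\<^theory>\<open>HOL-Algebra.Lattice\<close> hides the type class operations; the Boolean algebra
  is a type of class \<^class>\<open>boolean_algebra\<close>, so its operations are always the class ones.\<close>

hide_const (open) Lattice.inf Lattice.sup Order.top

section \<open>Modal algebras and finite quotients\<close>

locale modal_algebra =
  fixes dia :: "'a::boolean_algebra \<Rightarrow> 'a"
  assumes dia_bot: "dia bot = bot"
    and dia_sup: "dia (sup a b) = sup (dia a) (dia b)"

definition modal_congruence :: "('a::boolean_algebra \<Rightarrow> 'a) \<Rightarrow> ('a \<times> 'a) set \<Rightarrow> bool" where
  "modal_congruence dia \<theta> \<longleftrightarrow> equiv UNIV \<theta> \<and>
     (\<forall>a a' b b'. (a, a') \<in> \<theta> \<longrightarrow> (b, b') \<in> \<theta> \<longrightarrow> (inf a b, inf a' b') \<in> \<theta>) \<and>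
     (\<forall>a a' b b'. (a, a') \<in> \<theta> \<longrightarrow> (b, b') \<in> \<theta> \<longrightarrow> (sup a b, sup a' b') \<in> \<theta>) \<and>
     (\<forall>a a'. (a, a') \<in> \<theta> \<longrightarrow> (- a, - a') \<in> \<theta>) \<and>
     (\<forall>a a'. (a, a') \<in> \<theta> \<longrightarrow> (dia a, dia a') \<in> \<theta>)"

definition fin_congs :: "('a::boolean_algebra \<Rightarrow> 'a) \<Rightarrow> ('a \<times> 'a) set set" where
  "fin_congs dia = {\<theta>. modal_congruence dia \<theta> \<and> finite (UNIV // \<theta>)}"

definition residually_finite :: "('a::boolean_algebra \<Rightarrow> 'a) \<Rightarrow> bool" where
  "residually_finite dia \<longleftrightarrow> (\<forall>a b. a \<noteq> b \<longrightarrow> (\<exists>\<theta>\<in>fin_congs dia. \<theta> `` {a} \<noteq> \<theta> `` {b}))"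

section \<open>The profinite completion\<close>

text \<open>For a congruence \<open>\<theta>\<close> and congruence classes \<open>X = a/\<theta>\<close>, \<open>Y = b/\<theta>\<close> this is \<open>(f a b)/\<theta>\<close>.\<close>

definition quot_op :: "('a \<Rightarrow> 'a \<Rightarrow> 'a) \<Rightarrow> ('a \<times> 'a) set \<Rightarrow> 'a set \<Rightarrow> 'a set \<Rightarrow> 'a set" where
  "quot_op f \<theta> X Y = (\<Union>a\<in>X. \<Union>b\<in>Y. \<theta> `` {f a b})"

definition prof_carrier ::
    "('a::boolean_algebra \<Rightarrow> 'a) \<Rightarrow> (('a \<times> 'a) set \<Rightarrow> 'a set) set" where
  "prof_carrier dia = {\<alpha> \<in> (\<Pi>\<^sub>E \<theta>\<in>fin_congs dia. UNIV // \<theta>).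
     \<forall>\<theta>\<in>fin_congs dia. \<forall>\<psi>\<in>fin_congs dia. \<theta> \<subseteq> \<psi> \<longrightarrow>
       (\<forall>a. \<alpha> \<theta> = \<theta> `` {a} \<longrightarrow> \<alpha> \<psi> = \<psi> `` {a})}"

definition prof_op :: "('a::boolean_algebra \<Rightarrow> 'a) \<Rightarrow> ('a \<Rightarrow> 'a \<Rightarrow> 'a) \<Rightarrow>
    (('a \<times> 'a) set \<Rightarrow> 'a set) \<Rightarrow> (('a \<times> 'a) set \<Rightarrow> 'a set) \<Rightarrow> ('a \<times> 'a) set \<Rightarrow> 'a set" where
  "prof_op dia f \<alpha> \<beta> = (\<lambda>\<theta>\<in>fin_congs dia. quot_op f \<theta> (\<alpha> \<theta>) (\<beta> \<theta>))"

text \<open>The underlying lattice, given by the order of the coordinatewise meet. That its binary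
  meets and joins are the coordinatewise ones is shown below.\<close>

definition profinite_completion ::
    "('a::boolean_algebra \<Rightarrow> 'a) \<Rightarrow> (('a \<times> 'a) set \<Rightarrow> 'a set) gorder" where
  "profinite_completion dia =
     \<lparr>carrier = prof_carrier dia, eq = (=), le = (\<lambda>\<alpha> \<beta>. prof_op dia inf \<alpha> \<beta> = \<alpha>)\<rparr>"

definition prof_embed ::
    "('a::boolean_algebra \<Rightarrow> 'a) \<Rightarrow> 'a \<Rightarrow> ('a \<times> 'a) set \<Rightarrow> 'a set" where
  "prof_embed dia a = (\<lambda>\<theta>\<in>fin_congs dia. \<theta> `` {a})"

section \<open>Completions\<close>

definition completion :: "('a::lattice \<Rightarrow> 'c) \<Rightarrow> 'c gorder \<Rightarrow> bool" where
  "completion m C \<longleftrightarrow> complete_lattice C \<and> range m \<subseteq> carrier C \<and> inj m \<and>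
     (\<forall>a b. m (inf a b) = m a \<sqinter>\<^bsub>C\<^esub> m b) \<and> (\<forall>a b. m (sup a b) = m a \<squnion>\<^bsub>C\<^esub> m b)"

definition lattice_iso :: "('c \<Rightarrow> 'd) \<Rightarrow> 'c gorder \<Rightarrow> 'd gorder \<Rightarrow> bool" where
  "lattice_iso g C D \<longleftrightarrow> bij_betw g (carrier C) (carrier D) \<and>
     (\<forall>x\<in>carrier C. \<forall>y\<in>carrier C. g (x \<sqinter>\<^bsub>C\<^esub> y) = g x \<sqinter>\<^bsub>D\<^esub> g y \<and> g (x \<squnion>\<^bsub>C\<^esub> y) = g x \<squnion>\<^bsub>D\<^esub> g y)"

definition completion_iso ::
    "('a::lattice \<Rightarrow> 'c) \<Rightarrow> 'c gorder \<Rightarrow> ('a \<Rightarrow> 'd) \<Rightarrow> 'd gorder \<Rightarrow> bool" where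
  "completion_iso m C k D \<longleftrightarrow> completion m C \<and> completion k D \<and>
     (\<exists>g. lattice_iso g C D \<and> g \<circ> m = k)"

text \<open>Meet-density follows from join-density for Boolean embeddings into Boolean lattices, by
  taking complements. It has to be demanded here because completions are arbitrary complete
  lattices: without it the lattice of ideals would qualify, and uniqueness up to isomorphism
  would fail.\<close>

definition macneille_completion :: "('a::boolean_algebra \<Rightarrow> 'c) \<Rightarrow> 'c gorder \<Rightarrow> bool" where
  "macneille_completion m C \<longleftrightarrow> completion m C \<and>
     (\<forall>x\<in>carrier C. x = \<Squnion>\<^bsub>C\<^esub> {m a |a. m a \<sqsubseteq>\<^bsub>C\<^esub> x}) \<and>
     (\<forall>x\<in>carrier C. x = \<Sqinter>\<^bsub>C\<^esub> {m a |a. x \<sqsubseteq>\<^bsub>C\<^esub> m a})"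

definition lower_ext :: "('a \<Rightarrow> 'c) \<Rightarrow> 'c gorder \<Rightarrow> ('a \<Rightarrow> 'a) \<Rightarrow> 'c \<Rightarrow> 'c" where
  "lower_ext m C f x = \<Squnion>\<^bsub>C\<^esub> {m (f a) |a. m a \<sqsubseteq>\<^bsub>C\<^esub> x}"

definition upper_ext :: "('a \<Rightarrow> 'c) \<Rightarrow> 'c gorder \<Rightarrow> ('a \<Rightarrow> 'a) \<Rightarrow> 'c \<Rightarrow> 'c" where
  "upper_ext m C f x = \<Sqinter>\<^bsub>C\<^esub> {m (f a) |a. x \<sqsubseteq>\<^bsub>C\<^esub> m a}"

definition smooth :: "('a \<Rightarrow> 'c) \<Rightarrow> 'c gorder \<Rightarrow> ('a \<Rightarrow> 'a) \<Rightarrow> bool" where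
  "smooth m C f \<longleftrightarrow> (\<forall>x\<in>carrier C. lower_ext m C f x = upper_ext m C f x)"

section \<open>Existence and uniqueness of the MacNeille completion\<close>

lemma (in partial_order) sup_eqI: "least L s (Upper L A) \<Longrightarrow> \<Squnion>A = s"
  unfolding sup_def by (rule some_equality) (auto intro: least_unique)

lemma (in partial_order) inf_eqI: "greatest L s (Lower L A) \<Longrightarrow> \<Sqinter>A = s"
  unfolding inf_def by (rule some_equality) (auto intro: greatest_unique)

definition ubs :: "'a::order set \<Rightarrow> 'a set" where "ubs S = {u. \<forall>s\<in>S. s \<le> u}"
definition lbs :: "'a::order set \<Rightarrow> 'a set" where "lbs S = {l. \<forall>s\<in>S. l \<le> s}"

definition cuts :: "'a::order set gorder" where
  "cuts = \<lparr>carrier = {S. lbs (ubs S) = S}, eq = (=), le = (\<subseteq>)\<rparr>"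

lemma cuts_simps [simp]: "S \<in> carrier cuts \<longleftrightarrow> lbs (ubs S) = S" "S \<sqsubseteq>\<^bsub>cuts\<^esub> T \<longleftrightarrow> S \<subseteq> T"
  "S .=\<^bsub>cuts\<^esub> T \<longleftrightarrow> S = T"
  by (auto simp: cuts_def)

lemma cut_closed: "lbs (ubs (lbs (ubs S))) = lbs (ubs S)"
  by (auto simp: lbs_def ubs_def)

lemma cut_Iic: "lbs (ubs {..a}) = {..a}"
  by (auto simp: lbs_def ubs_def)

lemma cuts_partial_order: "partial_order cuts"
  by standard (auto simp: cuts_def)

lemma cuts_least:
  assumes "A \<subseteq> carrier cuts"
  shows "least cuts (lbs (ubs (\<Union>A))) (Upper cuts A)"
proof (rule least_UpperI)
  show "S \<sqsubseteq>\<^bsub>cuts\<^esub> lbs (ubs (\<Union>A))" if "S \<in> A" for S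
    using that by (auto simp: lbs_def ubs_def)
  show "lbs (ubs (\<Union>A)) \<sqsubseteq>\<^bsub>cuts\<^esub> T" if "T \<in> Upper cuts A" for T
  proof -
    have "lbs (ubs T) = T" using that by (auto simp: Upper_def)
    moreover have "\<Union>A \<subseteq> T" using that assms unfolding Upper_def by fastforce
    moreover from this have "lbs (ubs (\<Union>A)) \<subseteq> lbs (ubs T)"
      unfolding lbs_def ubs_def by blast
    ultimately show ?thesis by simp
  qed
qed (use assms cut_closed in auto)

lemma cuts_greatest:
  assumes "A \<subseteq> carrier cuts"
  shows "greatest cuts (\<Inter>A) (Lower cuts A)"
proof -
  have "lbs (ubs (\<Inter>A)) \<subseteq> S" if "S \<in> A" for S
  proof -
    have "lbs (ubs S) = S" using that assms by auto
    moreover have "ubs S \<subseteq> ubs (\<Inter>A)" using that by (auto simp: ubs_def)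
    ultimately show ?thesis by (auto simp: lbs_def)
  qed
  then have "lbs (ubs (\<Inter>A)) = \<Inter>A" by (auto simp: lbs_def ubs_def)
  then show ?thesis
    using assms by (auto simp: greatest_def Lower_def) (use cuts_simps(1) in blast)
qed

lemma cuts_complete_lattice: "complete_lattice cuts"
  by (rule partial_order.complete_latticeI[OF cuts_partial_order])
    (use cuts_least cuts_greatest in blast)+

theorem macneille_completion_cuts:
  "macneille_completion (\<lambda>a::'a::boolean_algebra. {..a}) cuts"
proof -
  interpret C: complete_lattice "cuts :: 'a set gorder" by (rule cuts_complete_lattice)
  have Sup: "\<Squnion>\<^bsub>cuts\<^esub> A = lbs (ubs (\<Union>A))" if "A \<subseteq> carrier cuts" for A :: "'a set set"
    using cuts_least[OF that] by (rule C.sup_eqI)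
  have Inf: "\<Sqinter>\<^bsub>cuts\<^esub> A = \<Inter>A" if "A \<subseteq> carrier cuts" for A :: "'a set set"
    using cuts_greatest[OF that] by (rule C.inf_eqI)
  have "{..inf a b} = {..a} \<sqinter>\<^bsub>cuts\<^esub> {..b}" for a b :: 'a
    unfolding meet_def by (subst Inf) (auto simp: cut_Iic)
  moreover have "{..sup a b} = {..a} \<squnion>\<^bsub>cuts\<^esub> {..b}" for a b :: 'a
  proof -
    have "ubs ({..a} \<union> {..b}) = {sup a b..}" by (auto simp: ubs_def)
    moreover have "lbs {sup a b..} = {..sup a b}"
      by (auto simp: lbs_def intro: order_trans)
    moreover have "{{..a}, {..b}} \<subseteq> carrier cuts" by (auto simp: cut_Iic)
    ultimately show ?thesis unfolding join_def by (simp add: Sup)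
  qed
  moreover have "S = \<Squnion>\<^bsub>cuts\<^esub> {{..a} |a. {..a} \<sqsubseteq>\<^bsub>cuts\<^esub> S}" if S: "S \<in> carrier cuts" for S :: "'a set"
  proof -
    have "{..a} \<subseteq> S" if "a \<in> S" for a
    proof -
      have "{..a} \<subseteq> lbs (ubs S)" using that by (fastforce simp: lbs_def ubs_def)
      then show ?thesis using S by simp
    qed
    then have "\<Union>{{..a} |a. {..a} \<subseteq> S} = S" by blast
    then show ?thesis using S by (subst Sup) (auto simp: cut_Iic)
  qed
  moreover have "S = \<Sqinter>\<^bsub>cuts\<^esub> {{..a} |a. S \<sqsubseteq>\<^bsub>cuts\<^esub> {..a}}" if S: "S \<in> carrier cuts" for S :: "'a set"
  proof -
    have "\<Inter>{{..a} |a. S \<subseteq> {..a}} = lbs (ubs S)" by (auto simp: lbs_def ubs_def)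
    then show ?thesis using S by (subst Inf) (auto simp: cut_Iic)
  qed
  ultimately show ?thesis
    unfolding macneille_completion_def completion_def
    using cuts_complete_lattice by (auto simp: cut_Iic inj_on_def)
qed

lemma completion_le_iff:
  assumes "completion m C"
  shows "m a \<sqsubseteq>\<^bsub>C\<^esub> m b \<longleftrightarrow> a \<le> b"
proof -
  interpret complete_lattice C using assms by (simp add: completion_def)
  have c: "m a \<in> carrier C" "m b \<in> carrier C" using assms by (auto simp: completion_def)
  have "m a \<sqsubseteq>\<^bsub>C\<^esub> m b \<longleftrightarrow> m a \<sqinter>\<^bsub>C\<^esub> m b = m a"
    using le_iff_join[OF c] by auto
  also have "\<dots> \<longleftrightarrow> m (inf a b) = m a" using assms by (simp add: completion_def)
  also have "\<dots> \<longleftrightarrow> inf a b = a" using assms by (metis completion_def inj_eq)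
  finally show ?thesis by (simp add: le_iff_inf)
qed

lemma macneille_transfer:
  assumes M: "macneille_completion m C" and K: "completion k D" and x: "x \<in> carrier C"
  shows "k b \<sqsubseteq>\<^bsub>D\<^esub> \<Squnion>\<^bsub>D\<^esub> {k a |a. m a \<sqsubseteq>\<^bsub>C\<^esub> x} \<longleftrightarrow> m b \<sqsubseteq>\<^bsub>C\<^esub> x"
proof
  have m: "completion m C" using M by (simp add: macneille_completion_def)
  interpret C: complete_lattice C using m by (simp add: completion_def)
  interpret D: complete_lattice D using K by (simp add: completion_def)
  have mc: "m a \<in> carrier C" for a using m by (auto simp: completion_def)
  have kc: "k a \<in> carrier D" for a using K by (auto simp: completion_def)
  let ?g = "\<Squnion>\<^bsub>D\<^esub> {k a |a. m a \<sqsubseteq>\<^bsub>C\<^esub> x}"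
  have gc: "?g \<in> carrier D" by (rule D.sup_closed) (auto simp: kc)
  show "k b \<sqsubseteq>\<^bsub>D\<^esub> ?g" if "m b \<sqsubseteq>\<^bsub>C\<^esub> x"
    by (rule D.sup_upper) (use that kc in auto)
  assume b: "k b \<sqsubseteq>\<^bsub>D\<^esub> ?g"
  have "m b \<sqsubseteq>\<^bsub>C\<^esub> \<Sqinter>\<^bsub>C\<^esub> {m c |c. x \<sqsubseteq>\<^bsub>C\<^esub> m c}"
  proof (rule C.inf_greatest)
    fix y assume "y \<in> {m c |c. x \<sqsubseteq>\<^bsub>C\<^esub> m c}"
    then obtain c where c: "y = m c" "x \<sqsubseteq>\<^bsub>C\<^esub> m c" by blast
    have "?g \<sqsubseteq>\<^bsub>D\<^esub> k c"
    proof (rule D.sup_least)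
      fix z assume "z \<in> {k a |a. m a \<sqsubseteq>\<^bsub>C\<^esub> x}"
      then obtain a where a: "z = k a" "m a \<sqsubseteq>\<^bsub>C\<^esub> x" by blast
      have "m a \<sqsubseteq>\<^bsub>C\<^esub> m c" using C.le_trans[OF a(2) c(2)] mc x by simp
      then show "z \<sqsubseteq>\<^bsub>D\<^esub> k c" by (simp add: a completion_le_iff[OF m] completion_le_iff[OF K])
    qed (auto simp: kc)
    then have "k b \<sqsubseteq>\<^bsub>D\<^esub> k c" using D.le_trans[OF b] kc gc by simp
    then show "m b \<sqsubseteq>\<^bsub>C\<^esub> y" by (simp add: c completion_le_iff[OF m] completion_le_iff[OF K])
  qed (auto simp: mc)
  then show "m b \<sqsubseteq>\<^bsub>C\<^esub> x" using M x by (simp add: macneille_completion_def)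
qed

lemma order_iso_lattice_iso:
  assumes "complete_lattice C" "complete_lattice D" and bij: "bij_betw g (carrier C) (carrier D)"
    and le: "\<And>x y. x \<in> carrier C \<Longrightarrow> y \<in> carrier C \<Longrightarrow> g x \<sqsubseteq>\<^bsub>D\<^esub> g y \<longleftrightarrow> x \<sqsubseteq>\<^bsub>C\<^esub> y"
  shows "lattice_iso g C D"
proof -
  interpret C: complete_lattice C by fact
  interpret D: complete_lattice D by fact
  have gc: "g x \<in> carrier D" if "x \<in> carrier C" for x using bij that by (auto simp: bij_betw_def)
  have ex: "\<exists>x\<in>carrier C. z = g x" if "z \<in> carrier D" for z
    using bij that by (auto simp: bij_betw_def)
  have "g (x \<sqinter>\<^bsub>C\<^esub> y) = g x \<sqinter>\<^bsub>D\<^esub> g y \<and> g (x \<squnion>\<^bsub>C\<^esub> y) = g x \<squnion>\<^bsub>D\<^esub> g y"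
    if xy: "x \<in> carrier C" "y \<in> carrier C" for x y
  proof
    have "is_glb D (g (x \<sqinter>\<^bsub>C\<^esub> y)) {g x, g y}"
    proof (rule greatest_LowerI)
      fix z assume "z \<in> Lower D {g x, g y}"
      then have z: "z \<in> carrier D" "z \<sqsubseteq>\<^bsub>D\<^esub> g x" "z \<sqsubseteq>\<^bsub>D\<^esub> g y" using gc xy by (auto simp: Lower_def)
      with ex obtain w where w: "w \<in> carrier C" "z = g w" by blast
      with z le xy have "w \<sqsubseteq>\<^bsub>C\<^esub> x \<sqinter>\<^bsub>C\<^esub> y" by (auto intro: C.meet_le)
      then show "z \<sqsubseteq>\<^bsub>D\<^esub> g (x \<sqinter>\<^bsub>C\<^esub> y)" using le w xy by simp
    qed (use gc xy le C.meet_left C.meet_right in auto)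
    then show "g (x \<sqinter>\<^bsub>C\<^esub> y) = g x \<sqinter>\<^bsub>D\<^esub> g y" unfolding meet_def by (simp add: D.inf_eqI)
    have "is_lub D (g (x \<squnion>\<^bsub>C\<^esub> y)) {g x, g y}"
    proof (rule least_UpperI)
      fix z assume "z \<in> Upper D {g x, g y}"
      then have z: "z \<in> carrier D" "g x \<sqsubseteq>\<^bsub>D\<^esub> z" "g y \<sqsubseteq>\<^bsub>D\<^esub> z" using gc xy by (auto simp: Upper_def)
      with ex obtain w where w: "w \<in> carrier C" "z = g w" by blast
      with z le xy have "x \<squnion>\<^bsub>C\<^esub> y \<sqsubseteq>\<^bsub>C\<^esub> w" by (auto intro: C.join_le)
      then show "g (x \<squnion>\<^bsub>C\<^esub> y) \<sqsubseteq>\<^bsub>D\<^esub> z" using le w xy by simp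
    qed (use gc xy le C.join_left C.join_right in auto)
    then show "g (x \<squnion>\<^bsub>C\<^esub> y) = g x \<squnion>\<^bsub>D\<^esub> g y" unfolding join_def by (simp add: D.sup_eqI)
  qed
  then show ?thesis using bij by (simp add: lattice_iso_def)
qed

theorem macneille_completion_unique:
  assumes M: "macneille_completion m C" and K: "macneille_completion k D"
  shows "completion_iso m C k D"
proof -
  have m: "completion m C" and k: "completion k D"
    using M K by (auto simp: macneille_completion_def)
  interpret C: complete_lattice C using m by (simp add: completion_def)
  interpret D: complete_lattice D using k by (simp add: completion_def)
  have mc: "m a \<in> carrier C" for a using m by (auto simp: completion_def)
  have kc: "k a \<in> carrier D" for a using k by (auto simp: completion_def)
  define g where "g x = \<Squnion>\<^bsub>D\<^esub> {k a |a. m a \<sqsubseteq>\<^bsub>C\<^esub> x}" for x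
  define h where "h y = \<Squnion>\<^bsub>C\<^esub> {m a |a. k a \<sqsubseteq>\<^bsub>D\<^esub> y}" for y
  have gc: "g x \<in> carrier D" for x unfolding g_def by (rule D.sup_closed) (auto simp: kc)
  have hc: "h y \<in> carrier C" for y unfolding h_def by (rule C.sup_closed) (auto simp: mc)
  have kg: "k b \<sqsubseteq>\<^bsub>D\<^esub> g x \<longleftrightarrow> m b \<sqsubseteq>\<^bsub>C\<^esub> x" if "x \<in> carrier C" for b x
    unfolding g_def by (rule macneille_transfer[OF M k that])
  have mh: "m b \<sqsubseteq>\<^bsub>C\<^esub> h y \<longleftrightarrow> k b \<sqsubseteq>\<^bsub>D\<^esub> y" if "y \<in> carrier D" for b y
    unfolding h_def by (rule macneille_transfer[OF K m that])
  have hg: "h (g x) = x" if "x \<in> carrier C" for x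
    using M that by (simp add: h_def kg macneille_completion_def)
  have gh: "g (h y) = y" if "y \<in> carrier D" for y
    using K that by (simp add: g_def mh macneille_completion_def)
  have gmono: "g x \<sqsubseteq>\<^bsub>D\<^esub> g y" if "x \<in> carrier C" "y \<in> carrier C" "x \<sqsubseteq>\<^bsub>C\<^esub> y" for x y
    unfolding g_def[of x]
  proof (rule D.sup_least)
    fix z assume "z \<in> {k a |a. m a \<sqsubseteq>\<^bsub>C\<^esub> x}"
    then obtain a where "z = k a" "m a \<sqsubseteq>\<^bsub>C\<^esub> x" by blast
    then show "z \<sqsubseteq>\<^bsub>D\<^esub> g y" using kg that C.le_trans[of "m a" x y] mc by simp
  qed (auto simp: kc gc)
  have hmono: "h x \<sqsubseteq>\<^bsub>C\<^esub> h y" if "x \<in> carrier D" "y \<in> carrier D" "x \<sqsubseteq>\<^bsub>D\<^esub> y" for x y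
    unfolding h_def[of x]
  proof (rule C.sup_least)
    fix z assume "z \<in> {m a |a. k a \<sqsubseteq>\<^bsub>D\<^esub> x}"
    then obtain a where "z = m a" "k a \<sqsubseteq>\<^bsub>D\<^esub> x" by blast
    then show "z \<sqsubseteq>\<^bsub>C\<^esub> h y" using mh that D.le_trans[of "k a" x y] kc by simp
  qed (auto simp: mc hc)
  have "bij_betw g (carrier C) (carrier D)"
    by (rule bij_betw_byWitness[where f' = h]) (use gc hc gh hg in auto)
  moreover have "g x \<sqsubseteq>\<^bsub>D\<^esub> g y \<longleftrightarrow> x \<sqsubseteq>\<^bsub>C\<^esub> y" if "x \<in> carrier C" "y \<in> carrier C" for x y
    using gmono hmono[OF gc gc] hg that by metis
  ultimately have "lattice_iso g C D"
    by (intro order_iso_lattice_iso C.complete_lattice_axioms D.complete_lattice_axioms)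
  moreover have "g (m a) = k a" for a
  proof -
    have "k a = \<Squnion>\<^bsub>D\<^esub> {k b |b. k b \<sqsubseteq>\<^bsub>D\<^esub> k a}"
      using K kc by (simp add: macneille_completion_def)
    then show ?thesis
      by (simp add: g_def completion_le_iff[OF m] completion_le_iff[OF k])
  qed
  ultimately show ?thesis
    unfolding completion_iso_def using m k by (auto simp: fun_eq_iff)
qed

section \<open>The lattice operations of the profinite completion\<close>

lemma fin_congs_equiv: "\<theta> \<in> fin_congs dia \<Longrightarrow> equiv UNIV \<theta>"
  by (simp add: fin_congs_def modal_congruence_def)

lemma quot_op_class:
  assumes "equiv UNIV \<theta>"
    and "\<And>a a' b b'. (a, a') \<in> \<theta> \<Longrightarrow> (b, b') \<in> \<theta> \<Longrightarrow> (f a b, f a' b') \<in> \<theta>"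
  shows "quot_op f \<theta> (\<theta> `` {a}) (\<theta> `` {b}) = \<theta> `` {f a b}"
proof -
  have "\<theta> `` {f a' b'} = \<theta> `` {f a b}" if "a' \<in> \<theta> `` {a}" "b' \<in> \<theta> `` {b}" for a' b'
    using equiv_class_eq[OF assms(1) assms(2)[of a a' b b']] that by simp
  moreover have "a \<in> \<theta> `` {a}" "b \<in> \<theta> `` {b}" using equiv_class_self[OF assms(1)] by auto
  ultimately show ?thesis unfolding quot_op_def by blast
qed

lemma quot_inf_sup:
  assumes "\<theta> \<in> fin_congs dia"
  shows "quot_op inf \<theta> (\<theta> `` {a}) (\<theta> `` {b}) = \<theta> `` {inf a b}"
    and "quot_op sup \<theta> (\<theta> `` {a}) (\<theta> `` {b}) = \<theta> `` {sup a b}"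
  by (rule quot_op_class[OF fin_congs_equiv[OF assms]];
      use assms in \<open>simp add: fin_congs_def modal_congruence_def\<close>)+

lemma prof_class:
  assumes "\<alpha> \<in> prof_carrier dia" "\<theta> \<in> fin_congs dia"
  obtains a where "\<alpha> \<theta> = \<theta> `` {a}"
    and "\<And>\<psi>. \<psi> \<in> fin_congs dia \<Longrightarrow> \<theta> \<subseteq> \<psi> \<Longrightarrow> \<alpha> \<psi> = \<psi> `` {a}"
proof -
  have "\<alpha> \<theta> \<in> UNIV // \<theta>" using assms unfolding prof_carrier_def by (blast dest: PiE_mem)
  then obtain a where "\<alpha> \<theta> = \<theta> `` {a}" by (rule quotientE)
  moreover from this have "\<alpha> \<psi> = \<psi> `` {a}" if "\<psi> \<in> fin_congs dia" "\<theta> \<subseteq> \<psi>" for \<psi>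
    using assms that unfolding prof_carrier_def by blast
  ultimately show thesis by (rule that)
qed

lemma prof_op_closed:
  assumes "\<alpha> \<in> prof_carrier dia" "\<beta> \<in> prof_carrier dia"
    and f: "\<And>\<theta> a b. \<theta> \<in> fin_congs dia \<Longrightarrow> quot_op f \<theta> (\<theta> `` {a}) (\<theta> `` {b}) = \<theta> `` {f a b}"
  shows "prof_op dia f \<alpha> \<beta> \<in> prof_carrier dia"
proof -
  have *: "\<exists>c. \<forall>\<psi>\<in>fin_congs dia. \<theta> \<subseteq> \<psi> \<longrightarrow> prof_op dia f \<alpha> \<beta> \<psi> = \<psi> `` {c}"
    if t: "\<theta> \<in> fin_congs dia" for \<theta>
  proof -
    obtain a where a: "\<And>\<psi>. \<psi> \<in> fin_congs dia \<Longrightarrow> \<theta> \<subseteq> \<psi> \<Longrightarrow> \<alpha> \<psi> = \<psi> `` {a}"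
      using prof_class[OF assms(1) t] by metis
    obtain b where b: "\<And>\<psi>. \<psi> \<in> fin_congs dia \<Longrightarrow> \<theta> \<subseteq> \<psi> \<Longrightarrow> \<beta> \<psi> = \<psi> `` {b}"
      using prof_class[OF assms(2) t] by metis
    show ?thesis by (rule exI[of _ "f a b"]) (simp add: prof_op_def a b f)
  qed
  have "prof_op dia f \<alpha> \<beta> \<theta> \<in> UNIV // \<theta>" if "\<theta> \<in> fin_congs dia" for \<theta>
    using *[OF that] that quotientI[OF UNIV_I] by (metis order_refl)
  moreover have "prof_op dia f \<alpha> \<beta> \<psi> = \<psi> `` {a}"
    if t: "\<theta> \<in> fin_congs dia" "\<psi> \<in> fin_congs dia" "\<theta> \<subseteq> \<psi>"
      and a: "prof_op dia f \<alpha> \<beta> \<theta> = \<theta> `` {a}" for \<theta> \<psi> a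
  proof -
    obtain c where c: "\<And>\<psi>. \<psi> \<in> fin_congs dia \<Longrightarrow> \<theta> \<subseteq> \<psi> \<Longrightarrow> prof_op dia f \<alpha> \<beta> \<psi> = \<psi> `` {c}"
      using *[OF t(1)] by metis
    have "\<theta> `` {a} = \<theta> `` {c}" using a c[OF t(1)] by simp
    then have "(a, c) \<in> \<theta>" using eq_equiv_class_iff[OF fin_congs_equiv[OF t(1)]] by auto
    then have "\<psi> `` {a} = \<psi> `` {c}" using equiv_class_eq[OF fin_congs_equiv[OF t(2)]] t(3) by blast
    then show ?thesis using c t by simp
  qed
  moreover have "prof_op dia f \<alpha> \<beta> \<in> extensional (fin_congs dia)" by (simp add: prof_op_def)
  ultimately show ?thesis unfolding prof_carrier_def PiE_iff by blast
qed

lemma prof_eqI: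
  assumes "\<alpha> \<in> prof_carrier dia" "\<beta> \<in> prof_carrier dia"
    and "\<And>\<theta>. \<theta> \<in> fin_congs dia \<Longrightarrow> \<alpha> \<theta> = \<beta> \<theta>"
  shows "\<alpha> = \<beta>"
  using assms(1,2) unfolding prof_carrier_def
  by (intro PiE_ext[where k = "fin_congs dia" and s = "\<lambda>\<theta>. UNIV // \<theta>"] assms(3)) simp_all

theorem profinite_completion_ops:
  assumes ab: "\<alpha> \<in> carrier (profinite_completion dia)" "\<beta> \<in> carrier (profinite_completion dia)"
  shows "\<alpha> \<sqinter>\<^bsub>profinite_completion dia\<^esub> \<beta> = prof_op dia inf \<alpha> \<beta>"
    and "\<alpha> \<squnion>\<^bsub>profinite_completion dia\<^esub> \<beta> = prof_op dia sup \<alpha> \<beta>"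
proof -
  let ?P = "profinite_completion dia" and ?F = "fin_congs dia"
  have P [simp]: "carrier ?P = prof_carrier dia" "x \<sqsubseteq>\<^bsub>?P\<^esub> y \<longleftrightarrow> prof_op dia inf x y = x"
    "x .=\<^bsub>?P\<^esub> y \<longleftrightarrow> x = y" for x y
    by (simp_all add: profinite_completion_def)
  have cl: "prof_op dia inf x y \<in> prof_carrier dia" "prof_op dia sup x y \<in> prof_carrier dia"
    if "x \<in> prof_carrier dia" "y \<in> prof_carrier dia" for x y
    using that by (auto intro!: prof_op_closed quot_inf_sup)
  have cls: "\<exists>a. x \<theta> = \<theta> `` {a}" if "x \<in> prof_carrier dia" "\<theta> \<in> ?F" for x \<theta>
    using prof_class[OF that] by metis
  have at: "prof_op dia f x y \<theta> = quot_op f \<theta> (x \<theta>) (y \<theta>)" if "\<theta> \<in> ?F" for f x y \<theta>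
    using that by (simp add: prof_op_def)
  have le_at: "x \<sqsubseteq>\<^bsub>?P\<^esub> y \<longleftrightarrow> (\<forall>\<theta>\<in>?F. quot_op inf \<theta> (x \<theta>) (y \<theta>) = x \<theta>)"
    if "x \<in> prof_carrier dia" "y \<in> prof_carrier dia" for x y
    unfolding P(2) using prof_eqI[OF cl(1)[OF that] that(1)] at[where f = inf] by metis
  have le_cls: "\<theta> `` {inf a b} = \<theta> `` {a}"
    if "x \<sqsubseteq>\<^bsub>?P\<^esub> y" "x \<in> prof_carrier dia" "y \<in> prof_carrier dia" "\<theta> \<in> ?F"
      "x \<theta> = \<theta> `` {a}" "y \<theta> = \<theta> `` {b}" for x y \<theta> a b
  proof -
    have "quot_op inf \<theta> (x \<theta>) (y \<theta>) = x \<theta>" using le_at that(1-4) by blast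
    then show ?thesis by (simp only: that(5,6) quot_inf_sup(1)[OF that(4)])
  qed
  interpret P: partial_order ?P
  proof
    fix x y z
    show "x \<sqsubseteq>\<^bsub>?P\<^esub> x" if x: "x \<in> carrier ?P"
    proof -
      have "quot_op inf \<theta> (x \<theta>) (x \<theta>) = x \<theta>" if t: "\<theta> \<in> ?F" for \<theta>
      proof -
        obtain a where "x \<theta> = \<theta> `` {a}" using cls[of x] x t by auto
        then show ?thesis by (simp add: quot_inf_sup(1)[OF t])
      qed
      then show ?thesis using x le_at by (simp del: P(2))
    qed
    show "x .=\<^bsub>?P\<^esub> y" if "x \<sqsubseteq>\<^bsub>?P\<^esub> y" "y \<sqsubseteq>\<^bsub>?P\<^esub> x" "x \<in> carrier ?P" "y \<in> carrier ?P"
    proof -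
      have xy: "x \<in> prof_carrier dia" "y \<in> prof_carrier dia" using that by simp_all
      have "x \<theta> = y \<theta>" if t: "\<theta> \<in> ?F" for \<theta>
      proof -
        obtain a b where ab: "x \<theta> = \<theta> `` {a}" "y \<theta> = \<theta> `` {b}"
          using cls[OF _ t] xy by meson
        then have "\<theta> `` {inf a b} = \<theta> `` {a}" "\<theta> `` {inf b a} = \<theta> `` {b}"
          using le_cls[OF \<open>x \<sqsubseteq>\<^bsub>?P\<^esub> y\<close> _ _ t] le_cls[OF \<open>y \<sqsubseteq>\<^bsub>?P\<^esub> x\<close> _ _ t] xy by blast+
        then show ?thesis by (simp add: ab inf.commute)
      qed
      then show ?thesis using prof_eqI that by simp blast
    qed
    show "x \<sqsubseteq>\<^bsub>?P\<^esub> z" if "x \<sqsubseteq>\<^bsub>?P\<^esub> y" "y \<sqsubseteq>\<^bsub>?P\<^esub> z" "x \<in> carrier ?P" "y \<in> carrier ?P" "z \<in> carrier ?P"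
    proof -
      have "quot_op inf \<theta> (x \<theta>) (z \<theta>) = x \<theta>" if t: "\<theta> \<in> ?F" for \<theta>
      proof -
        have xyz: "x \<in> prof_carrier dia" "y \<in> prof_carrier dia" "z \<in> prof_carrier dia"
          using \<open>x \<in> carrier ?P\<close> \<open>y \<in> carrier ?P\<close> \<open>z \<in> carrier ?P\<close> by simp_all
        obtain a b c where abc: "x \<theta> = \<theta> `` {a}" "y \<theta> = \<theta> `` {b}" "z \<theta> = \<theta> `` {c}"
          using cls[OF _ t] xyz by meson
        have ab: "\<theta> `` {inf a b} = \<theta> `` {a}" and bc: "\<theta> `` {inf b c} = \<theta> `` {b}"
          using le_cls[OF \<open>x \<sqsubseteq>\<^bsub>?P\<^esub> y\<close> _ _ t] le_cls[OF \<open>y \<sqsubseteq>\<^bsub>?P\<^esub> z\<close> _ _ t] xyz abc by blast+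
        have "\<theta> `` {inf a c} = quot_op inf \<theta> (\<theta> `` {inf a b}) (\<theta> `` {c})"
          by (simp add: ab quot_inf_sup(1)[OF t])
        also have "\<dots> = quot_op inf \<theta> (\<theta> `` {a}) (\<theta> `` {inf b c})"
          by (simp only: quot_inf_sup(1)[OF t] inf.assoc)
        also have "\<dots> = \<theta> `` {a}" by (simp add: ab bc quot_inf_sup(1)[OF t])
        finally show ?thesis by (simp add: abc quot_inf_sup(1)[OF t])
      qed
      then show ?thesis using that le_at by (simp del: P(2))
    qed
  qed (simp_all add: profinite_completion_def)
  have ab: "\<alpha> \<in> prof_carrier dia" "\<beta> \<in> prof_carrier dia" using ab by simp_all
  have "is_glb ?P (prof_op dia inf \<alpha> \<beta>) {\<alpha>, \<beta>}"
  proof (rule greatest_LowerI)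
    fix x assume "x \<in> {\<alpha>, \<beta>}"
    then have x: "x = \<alpha> \<or> x = \<beta>" by blast
    have "quot_op inf \<theta> (prof_op dia inf \<alpha> \<beta> \<theta>) (x \<theta>) = prof_op dia inf \<alpha> \<beta> \<theta>"
      if t: "\<theta> \<in> ?F" for \<theta>
    proof -
      obtain a b where "\<alpha> \<theta> = \<theta> `` {a}" "\<beta> \<theta> = \<theta> `` {b}" using cls[OF _ t] ab by meson
      then show ?thesis using x by (auto simp: at[OF t] quot_inf_sup[OF t] ac_simps)
    qed
    then show "prof_op dia inf \<alpha> \<beta> \<sqsubseteq>\<^bsub>?P\<^esub> x" using x ab cl le_at by (auto simp del: P(2))
  next
    fix y assume "y \<in> Lower ?P {\<alpha>, \<beta>}"
    then have y: "y \<in> prof_carrier dia" "y \<sqsubseteq>\<^bsub>?P\<^esub> \<alpha>" "y \<sqsubseteq>\<^bsub>?P\<^esub> \<beta>"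
      using ab by (auto simp: Lower_def simp del: P(2))
    have "quot_op inf \<theta> (y \<theta>) (prof_op dia inf \<alpha> \<beta> \<theta>) = y \<theta>" if t: "\<theta> \<in> ?F" for \<theta>
    proof -
      obtain a b c where abc: "\<alpha> \<theta> = \<theta> `` {a}" "\<beta> \<theta> = \<theta> `` {b}" "y \<theta> = \<theta> `` {c}"
        using cls[OF _ t] ab y(1) by meson
      have "\<theta> `` {inf c a} = \<theta> `` {c}" "\<theta> `` {inf c b} = \<theta> `` {c}"
        using le_cls[OF y(2) _ _ t] le_cls[OF y(3) _ _ t] y(1) ab abc by blast+
      then have "\<theta> `` {inf c (inf a b)} = \<theta> `` {c}"
        by (simp only: inf.assoc[symmetric] quot_inf_sup(1)[OF t, symmetric])
      then show ?thesis by (simp add: at[OF t] abc quot_inf_sup[OF t])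
    qed
    then show "y \<sqsubseteq>\<^bsub>?P\<^esub> prof_op dia inf \<alpha> \<beta>" using y ab cl le_at by (auto simp del: P(2))
  qed (use ab cl in auto)
  then show "\<alpha> \<sqinter>\<^bsub>?P\<^esub> \<beta> = prof_op dia inf \<alpha> \<beta>" unfolding meet_def by (rule P.inf_eqI)
  have "is_lub ?P (prof_op dia sup \<alpha> \<beta>) {\<alpha>, \<beta>}"
  proof (rule least_UpperI)
    fix x assume "x \<in> {\<alpha>, \<beta>}"
    then have x: "x = \<alpha> \<or> x = \<beta>" by blast
    have "quot_op inf \<theta> (x \<theta>) (prof_op dia sup \<alpha> \<beta> \<theta>) = x \<theta>" if t: "\<theta> \<in> ?F" for \<theta>
    proof -
      obtain a b where "\<alpha> \<theta> = \<theta> `` {a}" "\<beta> \<theta> = \<theta> `` {b}" using cls[OF _ t] ab by meson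
      then show ?thesis using x
        by (auto simp: at[OF t] quot_inf_sup[OF t] inf_sup_absorb sup.commute[of a b])
          (metis inf_sup_absorb sup.commute)+
    qed
    then show "x \<sqsubseteq>\<^bsub>?P\<^esub> prof_op dia sup \<alpha> \<beta>" using x ab cl le_at by (auto simp del: P(2))
  next
    fix y assume "y \<in> Upper ?P {\<alpha>, \<beta>}"
    then have y: "y \<in> prof_carrier dia" "\<alpha> \<sqsubseteq>\<^bsub>?P\<^esub> y" "\<beta> \<sqsubseteq>\<^bsub>?P\<^esub> y"
      using ab by (auto simp: Upper_def simp del: P(2))
    have "quot_op inf \<theta> (prof_op dia sup \<alpha> \<beta> \<theta>) (y \<theta>) = prof_op dia sup \<alpha> \<beta> \<theta>"
      if t: "\<theta> \<in> ?F" for \<theta>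
    proof -
      obtain a b c where abc: "\<alpha> \<theta> = \<theta> `` {a}" "\<beta> \<theta> = \<theta> `` {b}" "y \<theta> = \<theta> `` {c}"
        using cls[OF _ t] ab y(1) by meson
      have "\<theta> `` {inf a c} = \<theta> `` {a}" "\<theta> `` {inf b c} = \<theta> `` {b}"
        using le_cls[OF y(2) _ _ t] le_cls[OF y(3) _ _ t] y(1) ab abc by blast+
      then have "\<theta> `` {sup (inf a c) (inf b c)} = \<theta> `` {sup a b}"
        by (simp only: quot_inf_sup(2)[OF t, symmetric])
      then show ?thesis by (simp add: at[OF t] abc quot_inf_sup[OF t] inf_sup_distrib2)
    qed
    then show "prof_op dia sup \<alpha> \<beta> \<sqsubseteq>\<^bsub>?P\<^esub> y" using y ab cl le_at by (auto simp del: P(2))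
  qed (use ab cl in auto)
  then show "\<alpha> \<squnion>\<^bsub>?P\<^esub> \<beta> = prof_op dia sup \<alpha> \<beta>" unfolding join_def by (rule P.sup_eqI)
qed

end

theory Submission
  imports Defs
begin

text \<open>Compatible families of congruence classes have directed joins, and by finiteness of the
  quotients such a join agrees with some member of the directed set at each coordinate. Hence, if
  the embedding \<open>\<mu>\<close> is join-dense, let \<open>v\<close> be the join of \<open>\<mu>[0/\<theta>]\<close>, which vanishes at \<open>\<theta>\<close>; its
  complement is the directed join of the \<open>\<mu>(a)\<close> below it, so some such \<open>a\<close> lies in \<open>1/\<theta>\<close>, and it
  generates \<open>1/\<theta>\<close>.

  Conversely, if \<open>p\<close> generates \<open>1/\<theta>\<close>, then \<open>\<mu>(a \<and> p) \<le> \<alpha> \<le> \<mu>(a \<or> \<not>p)\<close> for every representative \<open>a\<close>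
  of \<open>\<alpha>\<close> at \<open>\<theta>\<close>, and these two bounds are congruent modulo \<open>\<theta>\<close>. By residual finiteness, such
  bounds for all \<open>\<theta>\<close> make \<open>\<mu>\<close> join- and meet-dense, and force the two extensions of \<open>\<Diamond>\<close> to
  coincide.\<close>

section \<open>Directed joins and density in ordered sets\<close>

definition directed :: "('a, 'b) gorder_scheme \<Rightarrow> 'a set \<Rightarrow> bool" where
  "directed L T \<longleftrightarrow> T \<subseteq> carrier L \<and> T \<noteq> {} \<and>
     (\<forall>x\<in>T. \<forall>y\<in>T. \<exists>z\<in>T. x \<sqsubseteq>\<^bsub>L\<^esub> z \<and> y \<sqsubseteq>\<^bsub>L\<^esub> z)"

lemma (in weak_partial_order) directed_finite_upper_bound:
  assumes T: "directed L T" and "finite F" and "F \<subseteq> T"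
  shows "\<exists>u\<in>T. \<forall>x\<in>F. x \<sqsubseteq> u"
  using assms(2,3)
proof (induction F rule: finite_induct)
  case empty
  show ?case using T by (auto simp: directed_def)
next
  case (insert x F)
  then obtain u where u: "u \<in> T" "\<forall>y\<in>F. y \<sqsubseteq> u" by blast
  then obtain z where z: "z \<in> T" "x \<sqsubseteq> z" "u \<sqsubseteq> z"
    using T insert.prems unfolding directed_def by blast
  have "T \<subseteq> carrier L" using T by (simp add: directed_def)
  then have "y \<sqsubseteq> z" if "y \<in> F" for y
    using that u z insert.prems by (intro le_trans[of y u z]) auto
  then show ?case using z by blast
qed

lemma (in upper_semilattice) complete_lattice_if_directed_joins:
  assumes bottom: "least L b (carrier L)"
    and joins: "\<And>T. directed L T \<Longrightarrow> \<exists>s. least L s (Upper L T)"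
  shows "complete_lattice L"
proof (rule complete_lattice_criterion1)
  show meets: "\<exists>i. greatest L i (Lower L A)" if A: "A \<subseteq> carrier L" for A
  proof -
    have "b \<in> Lower L A" using bottom A by (auto simp: least_def Lower_def)
    moreover have "x \<squnion> y \<in> Lower L A \<and> x \<sqsubseteq> x \<squnion> y \<and> y \<sqsubseteq> x \<squnion> y"
      if "x \<in> Lower L A" "y \<in> Lower L A" for x y
      using that A by (auto simp: Lower_def intro: join_le join_left join_right)
    ultimately have "directed L (Lower L A)"
      unfolding directed_def by (metis Lower_closed empty_iff)
    then obtain s where "least L s (Upper L (Lower L A))" using joins by blast
    then have "greatest L s (Lower L A)"
      using A by (auto simp: least_def greatest_def Upper_def Lower_def)
    then show ?thesis ..
  qed
  show "\<exists>g. greatest L g (carrier L)" using meets[of "{}"] by simp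
qed

lemma (in complete_lattice) dual_complete_lattice: "complete_lattice (inv_gorder L)"
  by (rule partial_order.complete_latticeI[OF dual_order])
    (simp_all add: sup_exists inf_exists)

lemma (in complete_lattice) join_dense_iff:
  assumes m: "\<And>a. m a \<in> carrier L"
  shows "(\<forall>x\<in>carrier L. x = \<Squnion>{m a |a. m a \<sqsubseteq> x}) \<longleftrightarrow>
    (\<forall>x\<in>carrier L. \<forall>y\<in>carrier L. (\<forall>a. m a \<sqsubseteq> x \<longrightarrow> m a \<sqsubseteq> y) \<longrightarrow> x \<sqsubseteq> y)"
    (is "?joins \<longleftrightarrow> ?dense")
proof
  have sub: "{m a |a. m a \<sqsubseteq> x} \<subseteq> carrier L" for x using m by blast
  show ?dense if ?joins
  proof (intro ballI impI)
    fix x y assume x: "x \<in> carrier L" and y: "y \<in> carrier L" "\<forall>a. m a \<sqsubseteq> x \<longrightarrow> m a \<sqsubseteq> y"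
    then have "\<Squnion>{m a |a. m a \<sqsubseteq> x} \<sqsubseteq> y" by (intro sup_least sub) auto
    then show "x \<sqsubseteq> y" using that x by simp
  qed
  show ?joins if dense: ?dense
  proof
    fix x assume x: "x \<in> carrier L"
    let ?s = "\<Squnion>{m a |a. m a \<sqsubseteq> x}"
    have s: "?s \<in> carrier L" by (rule sup_closed[OF sub])
    have "m a \<sqsubseteq> ?s" if "m a \<sqsubseteq> x" for a using that by (intro sup_upper sub) auto
    then have "x \<sqsubseteq> ?s" using dense x s by blast
    moreover have "?s \<sqsubseteq> x" using x by (intro sup_least sub) auto
    ultimately show "x = ?s" using x s by (rule le_antisym)
  qed
qed

lemma (in complete_lattice) meet_dense_iff:
  assumes "\<And>a. m a \<in> carrier L"
  shows "(\<forall>x\<in>carrier L. x = \<Sqinter>{m a |a. x \<sqsubseteq> m a}) \<longleftrightarrow>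
    (\<forall>x\<in>carrier L. \<forall>y\<in>carrier L. (\<forall>a. x \<sqsubseteq> m a \<longrightarrow> y \<sqsubseteq> m a) \<longrightarrow> y \<sqsubseteq> x)"
  using complete_lattice.join_dense_iff[OF dual_complete_lattice, of m] assms by simp

section \<open>Completions\<close>

lemma completion_closed: "completion m C \<Longrightarrow> m a \<in> carrier C"
  by (auto simp: completion_def)

lemma completion_complete_lattice: "completion m C \<Longrightarrow> complete_lattice C"
  by (simp add: completion_def)

lemma macneille_completionD: "macneille_completion m C \<Longrightarrow> completion m C"
  by (simp add: macneille_completion_def)

lemma macneille_completion_iff:
  "macneille_completion m C \<longleftrightarrow> completion m C \<and>
    (\<forall>x\<in>carrier C. \<forall>y\<in>carrier C. (\<forall>a. m a \<sqsubseteq>\<^bsub>C\<^esub> x \<longrightarrow> m a \<sqsubseteq>\<^bsub>C\<^esub> y) \<longrightarrow> x \<sqsubseteq>\<^bsub>C\<^esub> y) \<and>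
    (\<forall>x\<in>carrier C. \<forall>y\<in>carrier C. (\<forall>a. x \<sqsubseteq>\<^bsub>C\<^esub> m a \<longrightarrow> y \<sqsubseteq>\<^bsub>C\<^esub> m a) \<longrightarrow> y \<sqsubseteq>\<^bsub>C\<^esub> x)"
proof (cases "completion m C")
  case True
  then interpret complete_lattice C by (rule completion_complete_lattice)
  show ?thesis
    unfolding macneille_completion_def join_dense_iff[OF completion_closed[OF True]]
      meet_dense_iff[OF completion_closed[OF True]] ..
qed (simp add: macneille_completion_def)

lemma macneille_completion_join_dense:
  "macneille_completion m C \<Longrightarrow> x \<in> carrier C \<Longrightarrow> y \<in> carrier C \<Longrightarrow>
    (\<And>a. m a \<sqsubseteq>\<^bsub>C\<^esub> x \<Longrightarrow> m a \<sqsubseteq>\<^bsub>C\<^esub> y) \<Longrightarrow> x \<sqsubseteq>\<^bsub>C\<^esub> y"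
  by (simp add: macneille_completion_iff)

lemma macneille_completion_meet_dense:
  "macneille_completion m C \<Longrightarrow> x \<in> carrier C \<Longrightarrow> y \<in> carrier C \<Longrightarrow>
    (\<And>a. x \<sqsubseteq>\<^bsub>C\<^esub> m a \<Longrightarrow> y \<sqsubseteq>\<^bsub>C\<^esub> m a) \<Longrightarrow> y \<sqsubseteq>\<^bsub>C\<^esub> x"
  by (simp add: macneille_completion_iff)

lemma macneille_completion_leI:
  assumes M: "macneille_completion m C" and x: "x \<in> carrier C" and y: "y \<in> carrier C"
    and le: "\<And>a b. m a \<sqsubseteq>\<^bsub>C\<^esub> x \<Longrightarrow> y \<sqsubseteq>\<^bsub>C\<^esub> m b \<Longrightarrow> a \<le> b"
  shows "x \<sqsubseteq>\<^bsub>C\<^esub> y"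
proof (rule macneille_completion_join_dense[OF M x y])
  fix a assume a: "m a \<sqsubseteq>\<^bsub>C\<^esub> x"
  have m: "completion m C" using M by (rule macneille_completionD)
  show "m a \<sqsubseteq>\<^bsub>C\<^esub> y"
    using M y completion_closed[OF m] completion_le_iff[OF m] le[OF a]
    by (metis macneille_completion_meet_dense)
qed

lemma lattice_iso_le_iff:
  assumes "lattice C" "lattice D" and g: "lattice_iso g C D"
    and x: "x \<in> carrier C" and y: "y \<in> carrier C"
  shows "g x \<sqsubseteq>\<^bsub>D\<^esub> g y \<longleftrightarrow> x \<sqsubseteq>\<^bsub>C\<^esub> y"
proof -
  interpret C: lattice C by fact
  interpret D: lattice D by fact
  have bij: "bij_betw g (carrier C) (carrier D)" using g by (simp add: lattice_iso_def)
  then have "g x \<sqsubseteq>\<^bsub>D\<^esub> g y \<longleftrightarrow> g x = g x \<sqinter>\<^bsub>D\<^esub> g y"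
    using x y by (intro D.le_iff_join) (auto simp: bij_betw_def)
  also have "\<dots> \<longleftrightarrow> g x = g (x \<sqinter>\<^bsub>C\<^esub> y)" using g x y by (simp add: lattice_iso_def)
  also have "\<dots> \<longleftrightarrow> x = x \<sqinter>\<^bsub>C\<^esub> y"
    using bij x C.meet_closed[OF x y] by (auto simp: bij_betw_def inj_on_eq_iff)
  also have "\<dots> \<longleftrightarrow> x \<sqsubseteq>\<^bsub>C\<^esub> y" using C.le_iff_join[OF x y] by simp
  finally show ?thesis .
qed

lemma completion_isoE:
  assumes "completion_iso k D m C"
  obtains g where "bij_betw g (carrier D) (carrier C)" and "\<And>a. g (k a) = m a"
    and "\<And>x y. x \<in> carrier D \<Longrightarrow> y \<in> carrier D \<Longrightarrow> g x \<sqsubseteq>\<^bsub>C\<^esub> g y \<longleftrightarrow> x \<sqsubseteq>\<^bsub>D\<^esub> y"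
proof -
  obtain g where g: "lattice_iso g D C" "g \<circ> k = m" and "completion k D" "completion m C"
    using assms unfolding completion_iso_def by blast
  then have "lattice D" "lattice C" by (simp_all add: completion_complete_lattice)
  then have "g x \<sqsubseteq>\<^bsub>C\<^esub> g y \<longleftrightarrow> x \<sqsubseteq>\<^bsub>D\<^esub> y" if "x \<in> carrier D" "y \<in> carrier D" for x y
    using lattice_iso_le_iff[OF _ _ g(1)] that by blast
  moreover have "bij_betw g (carrier D) (carrier C)" using g(1) by (simp add: lattice_iso_def)
  moreover have "g (k a) = m a" for a using g(2) by auto
  ultimately show thesis by (intro that)
qed

lemma macneille_completion_iso:
  assumes iso: "completion_iso k D m C" and M: "macneille_completion m C"
  shows "macneille_completion k D"
proof -
  have k: "completion k D" using iso by (simp add: completion_iso_def)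
  obtain g where g: "bij_betw g (carrier D) (carrier C)" "\<And>a. g (k a) = m a"
    and le: "\<And>x y. x \<in> carrier D \<Longrightarrow> y \<in> carrier D \<Longrightarrow> g x \<sqsubseteq>\<^bsub>C\<^esub> g y \<longleftrightarrow> x \<sqsubseteq>\<^bsub>D\<^esub> y"
    using iso by (rule completion_isoE) blast
  have "k a \<sqsubseteq>\<^bsub>D\<^esub> x \<longleftrightarrow> m a \<sqsubseteq>\<^bsub>C\<^esub> g x" "x \<sqsubseteq>\<^bsub>D\<^esub> k a \<longleftrightarrow> g x \<sqsubseteq>\<^bsub>C\<^esub> m a" if "x \<in> carrier D" for x a
    using le[OF that] le[OF _ that] completion_closed[OF k] g(2) by metis+
  then show ?thesis
    using M k bij_betwE[OF g(1)] unfolding macneille_completion_iff by (simp flip: le)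
qed

section \<open>Boolean congruences\<close>

text \<open>On the classes of a Boolean congruence this is the order of the quotient.\<close>

definition class_le :: "'a::ord set \<Rightarrow> 'a set \<Rightarrow> bool" where
  "class_le X Y \<longleftrightarrow> (\<exists>a\<in>X. \<exists>b\<in>Y. a \<le> b)"

lemma class_leI: "a \<in> X \<Longrightarrow> b \<in> Y \<Longrightarrow> a \<le> b \<Longrightarrow> class_le X Y"
  by (auto simp: class_le_def)

locale boolean_congruence =
  fixes \<theta> :: "('a::boolean_algebra \<times> 'a) set"
  assumes equiv: "equiv UNIV \<theta>"
    and inf_cong: "(a, a') \<in> \<theta> \<Longrightarrow> (b, b') \<in> \<theta> \<Longrightarrow> (inf a b, inf a' b') \<in> \<theta>"
    and sup_cong: "(a, a') \<in> \<theta> \<Longrightarrow> (b, b') \<in> \<theta> \<Longrightarrow> (sup a b, sup a' b') \<in> \<theta>"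
    and compl_cong: "(a, a') \<in> \<theta> \<Longrightarrow> (- a, - a') \<in> \<theta>"
begin

lemma refl: "(a, a) \<in> \<theta>"
  using equiv by (meson UNIV_I equiv_def refl_onD)

lemma sym: "(a, b) \<in> \<theta> \<Longrightarrow> (b, a) \<in> \<theta>"
  using equiv by (meson equiv_def symD)

lemma trans: "(a, b) \<in> \<theta> \<Longrightarrow> (b, c) \<in> \<theta> \<Longrightarrow> (a, c) \<in> \<theta>"
  using equiv by (meson equiv_def transD)

lemma class_eq_iff: "\<theta> `` {a} = \<theta> `` {b} \<longleftrightarrow> (a, b) \<in> \<theta>"
  using eq_equiv_class_iff[OF equiv] by blast

lemma class_eqI:
  assumes "X \<in> UNIV // \<theta>" "a \<in> X"
  shows "X = \<theta> `` {a}"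
  using quotient_eqI[OF equiv assms(1) quotientI[OF UNIV_I] assms(2) _ refl] refl by blast

lemma class_le_of_le: "a \<le> b \<Longrightarrow> class_le (\<theta> `` {a}) (\<theta> `` {b})"
  using refl by (auto intro: class_leI)

lemma class_le_class_iff: "class_le (\<theta> `` {a}) (\<theta> `` {b}) \<longleftrightarrow> (inf a b, a) \<in> \<theta>"
proof
  assume "class_le (\<theta> `` {a}) (\<theta> `` {b})"
  then obtain a' b' where a': "(a, a') \<in> \<theta>" and "(b, b') \<in> \<theta>" "a' \<le> b'"
    by (auto simp: class_le_def)
  then have "(inf a b, a') \<in> \<theta>" using inf_cong[of a a' b b'] by (simp add: inf.absorb1)
  then show "(inf a b, a) \<in> \<theta>" using a' sym trans by blast
next
  assume "(inf a b, a) \<in> \<theta>"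
  then show "class_le (\<theta> `` {a}) (\<theta> `` {b})"
    using sym refl by (intro class_leI[of "inf a b" _ b]) auto
qed

lemma class_le_trans:
  assumes "X \<in> UNIV // \<theta>" "Y \<in> UNIV // \<theta>" "Z \<in> UNIV // \<theta>" and "class_le X Y" "class_le Y Z"
  shows "class_le X Z"
proof -
  obtain a b where a: "a \<in> X" "b \<in> Y" "a \<le> b" using \<open>class_le X Y\<close> by (auto simp: class_le_def)
  obtain b' c where c: "b' \<in> Y" "c \<in> Z" "b' \<le> c" using \<open>class_le Y Z\<close> by (auto simp: class_le_def)
  have "(b, b') \<in> \<theta>" using in_quotient_imp_in_rel[OF equiv assms(2)] a c by blast
  then have "(a, inf a b') \<in> \<theta>"
    using inf_cong[OF refl[of a], of b b'] a(3) by (simp add: inf.absorb1)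
  then have "inf a b' \<in> X" using in_quotient_imp_closed[OF equiv assms(1) a(1)] by blast
  moreover have "inf a b' \<le> c" using c(3) by (rule le_infI2)
  ultimately show ?thesis using c(2) by (intro class_leI)
qed

lemma class_le_antisym:
  assumes X: "X \<in> UNIV // \<theta>" and Y: "Y \<in> UNIV // \<theta>" and "class_le X Y" "class_le Y X"
  shows "X = Y"
proof -
  obtain a b where a: "X = \<theta> `` {a}" and b: "Y = \<theta> `` {b}" using X Y by (meson quotientE)
  have "(inf a b, a) \<in> \<theta>" "(inf b a, b) \<in> \<theta>"
    using assms(3,4) unfolding a b class_le_class_iff by blast+
  then have "(a, b) \<in> \<theta>" using sym trans by (metis inf.commute)
  then show ?thesis by (simp only: a b class_eq_iff)
qed

lemma principal_iff:
  assumes p: "\<theta> `` {top} = {b. b \<ge> p}"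
  shows "(a, b) \<in> \<theta> \<longleftrightarrow> inf a p = inf b p"
proof
  have le: "inf c p \<le> d" if "(c, d) \<in> \<theta>" for c d
  proof -
    have "(top, sup (- c) d) \<in> \<theta>" using sup_cong[OF refl that, of "- c"] by simp
    then have "p \<le> sup (- c) d" using p by auto
    then show ?thesis using shunt1[of p c d] by (simp add: inf.commute)
  qed
  show "inf a p = inf b p" if "(a, b) \<in> \<theta>"
    using le[OF that] le[OF sym[OF that]] by (simp add: order_antisym)
next
  have "(top, p) \<in> \<theta>" using p by auto
  then have restrict: "(c, inf c p) \<in> \<theta>" for c using inf_cong[OF refl, of top p c] by simp
  show "(a, b) \<in> \<theta>" if "inf a p = inf b p"
    using that restrict[of a] restrict[of b] sym trans by metis
qed

end

lemma boolean_congruence_Int: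
  assumes "boolean_congruence \<theta>" "boolean_congruence \<psi>"
  shows "boolean_congruence (\<theta> \<inter> \<psi>)"
proof -
  interpret \<theta>: boolean_congruence \<theta> by fact
  interpret \<psi>: boolean_congruence \<psi> by fact
  show ?thesis
    by (rule boolean_congruence.intro, rule equivI)
      (auto intro!: refl_onI symI transI \<theta>.refl \<psi>.refl
        intro: \<theta>.sym \<psi>.sym \<theta>.trans \<psi>.trans \<theta>.inf_cong \<psi>.inf_cong \<theta>.sup_cong \<psi>.sup_cong
          \<theta>.compl_cong \<psi>.compl_cong)
qed

lemma finite_quotient_Int:
  assumes "finite (A // \<theta>)" "finite (A // \<psi>)"
  shows "finite (A // (\<theta> \<inter> \<psi>))"
proof (rule finite_subset)
  show "A // (\<theta> \<inter> \<psi>) \<subseteq> (\<lambda>(X, Y). X \<inter> Y) ` ((A // \<theta>) \<times> (A // \<psi>))"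
  proof
    fix X assume "X \<in> A // (\<theta> \<inter> \<psi>)"
    then obtain a where "a \<in> A" "X = (\<theta> \<inter> \<psi>) `` {a}" by (blast elim: quotientE)
    moreover from this have "X = \<theta> `` {a} \<inter> \<psi> `` {a}" by blast
    ultimately show "X \<in> (\<lambda>(X, Y). X \<inter> Y) ` ((A // \<theta>) \<times> (A // \<psi>))"
      by (auto intro!: image_eqI[of _ _ "(\<theta> `` {a}, \<psi> `` {a})"] quotientI)
  qed
qed (use assms in simp)

section \<open>Finite congruences of modal algebras\<close>

lemma (in modal_algebra) mono_dia: "mono dia"
proof
  fix a b :: 'a assume "a \<le> b"
  then show "dia a \<le> dia b" using dia_sup[of a b] by (simp add: le_iff_sup)
qed

lemma fin_congs_iff:
  "\<theta> \<in> fin_congs dia \<longleftrightarrow> boolean_congruence \<theta> \<and>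
    (\<forall>a b. (a, b) \<in> \<theta> \<longrightarrow> (dia a, dia b) \<in> \<theta>) \<and> finite (UNIV // \<theta>)"
  unfolding fin_congs_def modal_congruence_def boolean_congruence_def by blast

lemma fin_congs_boolean_congruence: "\<theta> \<in> fin_congs dia \<Longrightarrow> boolean_congruence \<theta>"
  by (simp add: fin_congs_iff)

lemma fin_congs_dia: "\<theta> \<in> fin_congs dia \<Longrightarrow> (a, b) \<in> \<theta> \<Longrightarrow> (dia a, dia b) \<in> \<theta>"
  by (simp add: fin_congs_iff)

lemma fin_congs_Int:
  "\<theta> \<in> fin_congs dia \<Longrightarrow> \<psi> \<in> fin_congs dia \<Longrightarrow> \<theta> \<inter> \<psi> \<in> fin_congs dia"
  by (simp add: fin_congs_iff boolean_congruence_Int finite_quotient_Int)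

lemma residually_finite_leI:
  assumes "residually_finite dia"
    and le: "\<And>\<theta>. \<theta> \<in> fin_congs dia \<Longrightarrow> class_le (\<theta> `` {a}) (\<theta> `` {b})"
  shows "a \<le> b"
proof -
  have "\<theta> `` {inf a b} = \<theta> `` {a}" if "\<theta> \<in> fin_congs dia" for \<theta>
  proof -
    interpret boolean_congruence \<theta> using that by (rule fin_congs_boolean_congruence)
    show ?thesis using le[OF that] unfolding class_le_class_iff class_eq_iff .
  qed
  then have "inf a b = a" using assms(1) unfolding residually_finite_def by blast
  then show ?thesis by (simp add: inf.absorb_iff1)
qed

section \<open>Coordinates in the profinite completion\<close>

lemma prof_carrier_iff:
  "\<alpha> \<in> prof_carrier dia \<longleftrightarrow> \<alpha> \<in> (\<Pi>\<^sub>E \<theta>\<in>fin_congs dia. UNIV // \<theta>) \<and>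
    (\<forall>\<theta>\<in>fin_congs dia. \<forall>\<psi>\<in>fin_congs dia. \<theta> \<subseteq> \<psi> \<longrightarrow> \<alpha> \<theta> \<subseteq> \<alpha> \<psi>)"
proof -
  have "(\<forall>a. \<alpha> \<theta> = \<theta> `` {a} \<longrightarrow> \<alpha> \<psi> = \<psi> `` {a}) \<longleftrightarrow> \<alpha> \<theta> \<subseteq> \<alpha> \<psi>"
    if \<alpha>: "\<alpha> \<in> (\<Pi>\<^sub>E \<theta>\<in>fin_congs dia. UNIV // \<theta>)"
      and \<theta>: "\<theta> \<in> fin_congs dia" and \<psi>: "\<psi> \<in> fin_congs dia" and "\<theta> \<subseteq> \<psi>" for \<theta> \<psi>
  proof -
    interpret \<theta>: boolean_congruence \<theta> using \<theta> by (rule fin_congs_boolean_congruence)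
    interpret \<psi>: boolean_congruence \<psi> using \<psi> by (rule fin_congs_boolean_congruence)
    obtain a where a: "\<alpha> \<theta> = \<theta> `` {a}" using PiE_mem[OF \<alpha> \<theta>] by (rule quotientE)
    obtain b where b: "\<alpha> \<psi> = \<psi> `` {b}" using PiE_mem[OF \<alpha> \<psi>] by (rule quotientE)
    show ?thesis
      unfolding a b \<theta>.class_eq_iff \<psi>.class_eq_iff
      using \<open>\<theta> \<subseteq> \<psi>\<close> \<theta>.refl[of a] \<psi>.sym \<psi>.trans by blast
  qed
  then show ?thesis unfolding prof_carrier_def by (simp cong: conj_cong)
qed

lemma prof_class:
  "\<alpha> \<in> prof_carrier dia \<Longrightarrow> \<theta> \<in> fin_congs dia \<Longrightarrow> \<alpha> \<theta> \<in> UNIV // \<theta>"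
  by (simp add: prof_carrier_iff PiE_iff)

lemma prof_class_mono:
  "\<alpha> \<in> prof_carrier dia \<Longrightarrow> \<theta> \<in> fin_congs dia \<Longrightarrow> \<psi> \<in> fin_congs dia \<Longrightarrow> \<theta> \<subseteq> \<psi> \<Longrightarrow> \<alpha> \<theta> \<subseteq> \<alpha> \<psi>"
  by (simp add: prof_carrier_iff)

lemma prof_class_subset_if_le:
  assumes \<alpha>: "\<alpha> \<in> prof_carrier dia" and \<beta>: "\<beta> \<in> prof_carrier dia"
    and \<theta>: "\<theta> \<in> fin_congs dia" and \<psi>: "\<psi> \<in> fin_congs dia" and "\<theta> \<subseteq> \<psi>"
    and le: "class_le (\<beta> \<theta>) (\<alpha> \<theta>)" "class_le (\<alpha> \<psi>) (\<beta> \<psi>)"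
  shows "\<alpha> \<theta> \<subseteq> \<beta> \<psi>"
proof -
  interpret boolean_congruence \<psi> using \<psi> by (rule fin_congs_boolean_congruence)
  have mono: "\<alpha> \<theta> \<subseteq> \<alpha> \<psi>" "\<beta> \<theta> \<subseteq> \<beta> \<psi>"
    using prof_class_mono[OF _ \<theta> \<psi> \<open>\<theta> \<subseteq> \<psi>\<close>] \<alpha> \<beta> by blast+
  then have "class_le (\<beta> \<psi>) (\<alpha> \<psi>)" using le(1) by (auto simp: class_le_def)
  with le(2) have "\<alpha> \<psi> = \<beta> \<psi>"
    by (rule class_le_antisym[OF prof_class[OF \<alpha> \<psi>] prof_class[OF \<beta> \<psi>]])
  then show ?thesis using mono(1) by simp
qed

lemma prof_class_nonempty:
  "\<alpha> \<in> prof_carrier dia \<Longrightarrow> \<theta> \<in> fin_congs dia \<Longrightarrow> \<alpha> \<theta> \<noteq> {}"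
  by (rule in_quotient_imp_non_empty[OF fin_congs_equiv prof_class])

lemma prof_class_common:
  assumes \<alpha>: "\<alpha> \<in> prof_carrier dia" and \<theta>: "\<theta> \<in> fin_congs dia" and \<psi>: "\<psi> \<in> fin_congs dia"
  shows "\<alpha> \<theta> \<inter> \<alpha> \<psi> \<noteq> {}"
proof -
  have "\<theta> \<inter> \<psi> \<in> fin_congs dia" using \<theta> \<psi> by (rule fin_congs_Int)
  then have "\<alpha> (\<theta> \<inter> \<psi>) \<noteq> {}" "\<alpha> (\<theta> \<inter> \<psi>) \<subseteq> \<alpha> \<theta>" "\<alpha> (\<theta> \<inter> \<psi>) \<subseteq> \<alpha> \<psi>"
    using prof_class_nonempty[OF \<alpha>] prof_class_mono[OF \<alpha>] \<theta> \<psi> by simp_all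
  then show ?thesis by blast
qed

lemma prof_eq_if_common:
  assumes "\<alpha> \<in> prof_carrier dia" "\<beta> \<in> prof_carrier dia"
    and "\<And>\<theta>. \<theta> \<in> fin_congs dia \<Longrightarrow> \<alpha> \<theta> \<inter> \<beta> \<theta> \<noteq> {}"
  shows "\<alpha> = \<beta>"
  by (rule prof_eqI) (use assms quotient_disj[OF fin_congs_equiv] prof_class in blast)+

lemma prof_op_mem:
  assumes "\<theta> \<in> fin_congs dia" "a \<in> \<alpha> \<theta>" "b \<in> \<beta> \<theta>"
  shows "f a b \<in> prof_op dia f \<alpha> \<beta> \<theta>"
  using assms equiv_class_self[OF fin_congs_equiv] by (fastforce simp: prof_op_def quot_op_def)

lemma prof_inf_closed:
  "\<alpha> \<in> prof_carrier dia \<Longrightarrow> \<beta> \<in> prof_carrier dia \<Longrightarrow> prof_op dia inf \<alpha> \<beta> \<in> prof_carrier dia"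
  by (rule prof_op_closed[OF _ _ quot_inf_sup(1)])

lemma prof_sup_closed:
  "\<alpha> \<in> prof_carrier dia \<Longrightarrow> \<beta> \<in> prof_carrier dia \<Longrightarrow> prof_op dia sup \<alpha> \<beta> \<in> prof_carrier dia"
  by (rule prof_op_closed[OF _ _ quot_inf_sup(2)])

lemma profinite_completion_simps [simp]:
  "carrier (profinite_completion dia) = prof_carrier dia"
  "\<alpha> .=\<^bsub>profinite_completion dia\<^esub> \<beta> \<longleftrightarrow> \<alpha> = \<beta>"
  by (simp_all add: profinite_completion_def)

lemma prof_le_iff:
  assumes \<alpha>: "\<alpha> \<in> prof_carrier dia" and \<beta>: "\<beta> \<in> prof_carrier dia"
  shows "\<alpha> \<sqsubseteq>\<^bsub>profinite_completion dia\<^esub> \<beta> \<longleftrightarrow> (\<forall>\<theta>\<in>fin_congs dia. class_le (\<alpha> \<theta>) (\<beta> \<theta>))"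
proof -
  have "prof_op dia inf \<alpha> \<beta> = \<alpha> \<longleftrightarrow> (\<forall>\<theta>\<in>fin_congs dia. class_le (\<alpha> \<theta>) (\<beta> \<theta>))"
  proof (intro iffI ballI)
    fix \<theta> assume eq: "prof_op dia inf \<alpha> \<beta> = \<alpha>" and \<theta>: "\<theta> \<in> fin_congs dia"
    obtain a b where "a \<in> \<alpha> \<theta>" and b: "b \<in> \<beta> \<theta>"
      using prof_class_nonempty[OF \<alpha> \<theta>] prof_class_nonempty[OF \<beta> \<theta>] by blast
    then have "inf a b \<in> \<alpha> \<theta>" using prof_op_mem[OF \<theta>, of a \<alpha> b \<beta> inf] eq by simp
    then show "class_le (\<alpha> \<theta>) (\<beta> \<theta>)" using b by (rule class_leI) simp
  next
    assume le: "\<forall>\<theta>\<in>fin_congs dia. class_le (\<alpha> \<theta>) (\<beta> \<theta>)"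
    show "prof_op dia inf \<alpha> \<beta> = \<alpha>"
    proof (rule prof_eq_if_common[OF prof_inf_closed[OF \<alpha> \<beta>] \<alpha>])
      fix \<theta> assume \<theta>: "\<theta> \<in> fin_congs dia"
      then obtain a b where "a \<in> \<alpha> \<theta>" "b \<in> \<beta> \<theta>" "a \<le> b" using le by (auto simp: class_le_def)
      then have "a \<in> prof_op dia inf \<alpha> \<beta> \<theta>"
        using prof_op_mem[OF \<theta>, of a \<alpha> b \<beta> inf] by (simp add: inf.absorb1)
      then show "prof_op dia inf \<alpha> \<beta> \<theta> \<inter> \<alpha> \<theta> \<noteq> {}" using \<open>a \<in> \<alpha> \<theta>\<close> by blast
    qed
  qed
  then show ?thesis by (simp add: profinite_completion_def)
qed

lemma prof_partial_order: "partial_order (profinite_completion dia)" (is "partial_order ?P")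
proof
  show "\<alpha> \<sqsubseteq>\<^bsub>?P\<^esub> \<alpha>" if "\<alpha> \<in> carrier ?P" for \<alpha>
    using that prof_class_nonempty by (fastforce simp: prof_le_iff class_le_def)
  show "\<alpha> .=\<^bsub>?P\<^esub> \<beta>"
    if le: "\<alpha> \<sqsubseteq>\<^bsub>?P\<^esub> \<beta>" "\<beta> \<sqsubseteq>\<^bsub>?P\<^esub> \<alpha>" and "\<alpha> \<in> carrier ?P" "\<beta> \<in> carrier ?P" for \<alpha> \<beta>
  proof -
    have \<alpha>: "\<alpha> \<in> prof_carrier dia" and \<beta>: "\<beta> \<in> prof_carrier dia" using that by simp_all
    have "\<alpha> \<theta> = \<beta> \<theta>" if \<theta>: "\<theta> \<in> fin_congs dia" for \<theta>
      using boolean_congruence.class_le_antisym[OF fin_congs_boolean_congruence[OF \<theta>]]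
        prof_class[OF \<alpha> \<theta>] prof_class[OF \<beta> \<theta>] le \<theta> by (simp add: prof_le_iff \<alpha> \<beta>)
    then show ?thesis using prof_eqI[OF \<alpha> \<beta>] by simp
  qed
  show "\<alpha> \<sqsubseteq>\<^bsub>?P\<^esub> \<gamma>"
    if le: "\<alpha> \<sqsubseteq>\<^bsub>?P\<^esub> \<beta>" "\<beta> \<sqsubseteq>\<^bsub>?P\<^esub> \<gamma>"
      and "\<alpha> \<in> carrier ?P" "\<beta> \<in> carrier ?P" "\<gamma> \<in> carrier ?P" for \<alpha> \<beta> \<gamma>
  proof -
    have carrier: "\<alpha> \<in> prof_carrier dia" "\<beta> \<in> prof_carrier dia" "\<gamma> \<in> prof_carrier dia"
      using that by simp_all
    have "class_le (\<alpha> \<theta>) (\<gamma> \<theta>)" if \<theta>: "\<theta> \<in> fin_congs dia" for \<theta>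
      using boolean_congruence.class_le_trans[OF fin_congs_boolean_congruence[OF \<theta>]
          prof_class[OF carrier(1) \<theta>] prof_class[OF carrier(2) \<theta>] prof_class[OF carrier(3) \<theta>]]
        le \<theta> by (simp add: prof_le_iff carrier)
    then show ?thesis by (simp add: prof_le_iff carrier)
  qed
qed (simp_all, simp add: profinite_completion_def)

lemma prof_sup_least:
  assumes \<alpha>: "\<alpha> \<in> prof_carrier dia" and \<beta>: "\<beta> \<in> prof_carrier dia" and \<gamma>: "\<gamma> \<in> prof_carrier dia"
    and le: "\<alpha> \<sqsubseteq>\<^bsub>profinite_completion dia\<^esub> \<gamma>" "\<beta> \<sqsubseteq>\<^bsub>profinite_completion dia\<^esub> \<gamma>"
  shows "prof_op dia sup \<alpha> \<beta> \<sqsubseteq>\<^bsub>profinite_completion dia\<^esub> \<gamma>"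
  unfolding prof_le_iff[OF prof_sup_closed[OF \<alpha> \<beta>] \<gamma>]
proof
  fix \<theta> assume \<theta>: "\<theta> \<in> fin_congs dia"
  interpret boolean_congruence \<theta> using \<theta> by (rule fin_congs_boolean_congruence)
  obtain a c where ac: "a \<in> \<alpha> \<theta>" "c \<in> \<gamma> \<theta>" "a \<le> c"
    using le(1) \<theta> by (auto simp: prof_le_iff \<alpha> \<gamma> class_le_def)
  obtain b d where bd: "b \<in> \<beta> \<theta>" "d \<in> \<gamma> \<theta>" "b \<le> d"
    using le(2) \<theta> by (auto simp: prof_le_iff \<beta> \<gamma> class_le_def)
  have "(c, d) \<in> \<theta>" using in_quotient_imp_in_rel[OF equiv prof_class[OF \<gamma> \<theta>]] ac bd by blast
  then have "(c, sup c d) \<in> \<theta>" using sup_cong[OF refl[of c], of c d] by simp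
  then have "sup c d \<in> \<gamma> \<theta>" by (rule in_quotient_imp_closed[OF equiv prof_class[OF \<gamma> \<theta>] ac(2)])
  then show "class_le (prof_op dia sup \<alpha> \<beta> \<theta>) (\<gamma> \<theta>)"
    using prof_op_mem[OF \<theta>, of a \<alpha> b \<beta> sup] ac(1,3) bd(1,3) by (blast intro: class_leI sup_mono)
qed

lemma prof_upper_semilattice: "upper_semilattice (profinite_completion dia)"
  (is "upper_semilattice ?P")
proof -
  interpret partial_order ?P by (rule prof_partial_order)
  have "least ?P (prof_op dia sup \<alpha> \<beta>) (Upper ?P {\<alpha>, \<beta>})"
    if \<alpha>: "\<alpha> \<in> prof_carrier dia" and \<beta>: "\<beta> \<in> prof_carrier dia" for \<alpha> \<beta>
  proof (rule least_UpperI)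
    have "class_le (\<alpha> \<theta>) (prof_op dia sup \<alpha> \<beta> \<theta>)" "class_le (\<beta> \<theta>) (prof_op dia sup \<alpha> \<beta> \<theta>)"
      if \<theta>: "\<theta> \<in> fin_congs dia" for \<theta>
    proof -
      obtain a b where ab: "a \<in> \<alpha> \<theta>" "b \<in> \<beta> \<theta>"
        using prof_class_nonempty[OF \<alpha> \<theta>] prof_class_nonempty[OF \<beta> \<theta>] by blast
      then show "class_le (\<alpha> \<theta>) (prof_op dia sup \<alpha> \<beta> \<theta>)" "class_le (\<beta> \<theta>) (prof_op dia sup \<alpha> \<beta> \<theta>)"
        using prof_op_mem[OF \<theta>, of a \<alpha> b \<beta> sup] by (blast intro: class_leI sup_ge1 sup_ge2)+
    qed
    then show "\<gamma> \<sqsubseteq>\<^bsub>?P\<^esub> prof_op dia sup \<alpha> \<beta>" if "\<gamma> \<in> {\<alpha>, \<beta>}" for \<gamma>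
      using that \<alpha> \<beta> by (auto simp: prof_le_iff prof_sup_closed)
    show "prof_op dia sup \<alpha> \<beta> \<sqsubseteq>\<^bsub>?P\<^esub> \<gamma>" if "\<gamma> \<in> Upper ?P {\<alpha>, \<beta>}" for \<gamma>
      using that \<alpha> \<beta> by (auto simp: Upper_def intro: prof_sup_least)
  qed (use \<alpha> \<beta> prof_sup_closed in auto)
  then show ?thesis by unfold_locales (simp, blast)
qed

section \<open>Completeness of the profinite completion\<close>

lemma prof_directed_attains_bound:
  assumes T: "directed (profinite_completion dia) T" and \<theta>: "\<theta> \<in> fin_congs dia"
  shows "\<exists>\<tau>\<in>T. \<forall>\<sigma>\<in>T. class_le (\<sigma> \<theta>) (\<tau> \<theta>)"
proof -
  interpret partial_order "profinite_completion dia" by (rule prof_partial_order)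
  have carrier: "T \<subseteq> prof_carrier dia" using T by (simp add: directed_def)
  then have "(\<lambda>\<sigma>. \<sigma> \<theta>) ` T \<subseteq> UNIV // \<theta>" using prof_class[OF _ \<theta>] by blast
  then have finite: "finite ((\<lambda>\<sigma>. \<sigma> \<theta>) ` T)" using \<theta> finite_subset by (auto simp: fin_congs_def)
  obtain F where F: "F \<subseteq> T" "finite F" "(\<lambda>\<sigma>. \<sigma> \<theta>) ` T = (\<lambda>\<sigma>. \<sigma> \<theta>) ` F"
    using finite_subset_image[OF finite subset_refl] by (elim exE conjE) (rule that)
  obtain \<tau> where \<tau>: "\<tau> \<in> T" "\<forall>\<sigma>\<in>F. \<sigma> \<sqsubseteq>\<^bsub>profinite_completion dia\<^esub> \<tau>"
    using directed_finite_upper_bound[OF T] F(1,2) by meson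
  have "class_le (\<sigma> \<theta>) (\<tau> \<theta>)" if "\<sigma> \<in> T" for \<sigma>
  proof -
    have "\<sigma> \<theta> \<in> (\<lambda>\<sigma>. \<sigma> \<theta>) ` F" unfolding F(3)[symmetric] using that by (rule imageI)
    then obtain \<rho> where \<rho>: "\<rho> \<in> F" "\<sigma> \<theta> = \<rho> \<theta>" by (rule imageE)
    then have "\<rho> \<in> prof_carrier dia" "\<tau> \<in> prof_carrier dia" using F(1) \<tau>(1) carrier by blast+
    then show ?thesis using \<tau>(2) \<rho> \<theta> by (metis prof_le_iff)
  qed
  then show ?thesis using \<tau>(1) by blast
qed

lemma prof_directed_join:
  assumes T: "directed (profinite_completion dia) T"
  obtains s where "least (profinite_completion dia) s (Upper (profinite_completion dia) T)"
    and "\<And>\<theta>. \<theta> \<in> fin_congs dia \<Longrightarrow> \<exists>\<tau>\<in>T. s \<theta> = \<tau> \<theta>"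
proof -
  let ?P = "profinite_completion dia"
  have carrier: "\<tau> \<in> prof_carrier dia" if "\<tau> \<in> T" for \<tau> using T that by (auto simp: directed_def)
  obtain t where t: "\<And>\<theta>. \<theta> \<in> fin_congs dia \<Longrightarrow> t \<theta> \<in> T"
    and bound: "\<And>\<theta> \<sigma>. \<theta> \<in> fin_congs dia \<Longrightarrow> \<sigma> \<in> T \<Longrightarrow> class_le (\<sigma> \<theta>) (t \<theta> \<theta>)"
    using prof_directed_attains_bound[OF T] by metis
  define s where "s = (\<lambda>\<theta>\<in>fin_congs dia. t \<theta> \<theta>)"
  have "t \<theta> \<theta> \<subseteq> t \<psi> \<psi>"
    if "\<theta> \<in> fin_congs dia" "\<psi> \<in> fin_congs dia" "\<theta> \<subseteq> \<psi>" for \<theta> \<psi>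
    using that by (intro prof_class_subset_if_le[OF carrier[OF t] carrier[OF t]] t bound)
  then have s: "s \<in> prof_carrier dia"
    using prof_class[OF carrier] t by (auto simp: s_def prof_carrier_iff)
  have "least ?P s (Upper ?P T)"
  proof (rule least_UpperI)
    show "\<tau> \<sqsubseteq>\<^bsub>?P\<^esub> s" if "\<tau> \<in> T" for \<tau>
      unfolding prof_le_iff[OF carrier[OF that] s] using bound that by (simp add: s_def)
    show "s \<sqsubseteq>\<^bsub>?P\<^esub> \<gamma>" if upper: "\<gamma> \<in> Upper ?P T" for \<gamma>
    proof -
      have \<gamma>: "\<gamma> \<in> prof_carrier dia" using upper by (simp add: Upper_def)
      have "\<tau> \<sqsubseteq>\<^bsub>?P\<^esub> \<gamma>" if "\<tau> \<in> T" for \<tau> using upper that carrier by (auto simp: Upper_def)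
      then have "class_le (t \<theta> \<theta>) (\<gamma> \<theta>)" if "\<theta> \<in> fin_congs dia" for \<theta>
        using prof_le_iff[OF carrier \<gamma>] t that by blast
      then show ?thesis unfolding prof_le_iff[OF s \<gamma>] by (simp add: s_def)
    qed
  qed (use carrier s in auto)
  then show thesis using t by (intro that) (auto simp: s_def)
qed

lemma prof_embed_carrier: "prof_embed dia a \<in> prof_carrier dia"
  by (auto simp: prof_embed_def prof_carrier_iff intro: quotientI)

lemma prof_embed_apply: "\<theta> \<in> fin_congs dia \<Longrightarrow> prof_embed dia a \<theta> = \<theta> `` {a}"
  by (simp add: prof_embed_def)

lemma prof_embed_mem: "\<theta> \<in> fin_congs dia \<Longrightarrow> a \<in> prof_embed dia a \<theta>"
  by (simp add: prof_embed_apply boolean_congruence.refl[OF fin_congs_boolean_congruence])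

lemma prof_embed_mono:
  "a \<le> b \<Longrightarrow> prof_embed dia a \<sqsubseteq>\<^bsub>profinite_completion dia\<^esub> prof_embed dia b"
  using prof_embed_mem by (auto simp: prof_le_iff prof_embed_carrier intro: class_leI)

lemma prof_embed_bot_least:
  assumes "\<alpha> \<in> prof_carrier dia"
  shows "prof_embed dia bot \<sqsubseteq>\<^bsub>profinite_completion dia\<^esub> \<alpha>"
proof -
  have "class_le (prof_embed dia bot \<theta>) (\<alpha> \<theta>)" if \<theta>: "\<theta> \<in> fin_congs dia" for \<theta>
    using prof_embed_mem[OF \<theta>] prof_class_nonempty[OF assms \<theta>]
    by (blast intro: class_leI bot_least)
  then show ?thesis by (simp add: prof_le_iff prof_embed_carrier assms)
qed

lemma prof_embed_directed:
  assumes "I \<noteq> {}" and "\<And>a b. a \<in> I \<Longrightarrow> b \<in> I \<Longrightarrow> sup a b \<in> I"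
  shows "directed (profinite_completion dia) (prof_embed dia ` I)"
  unfolding directed_def
proof (intro conjI ballI)
  fix \<alpha> \<beta> assume "\<alpha> \<in> prof_embed dia ` I" "\<beta> \<in> prof_embed dia ` I"
  then obtain a b where "\<alpha> = prof_embed dia a" "\<beta> = prof_embed dia b" "a \<in> I" "b \<in> I" by blast
  then show "\<exists>\<gamma>\<in>prof_embed dia ` I. \<alpha> \<sqsubseteq>\<^bsub>profinite_completion dia\<^esub> \<gamma> \<and>
      \<beta> \<sqsubseteq>\<^bsub>profinite_completion dia\<^esub> \<gamma>"
    using assms(2)
    by (intro bexI[of _ "prof_embed dia (sup a b)"]) (simp_all add: prof_embed_mono)
qed (use assms(1) prof_embed_carrier in auto)

lemma prof_complete_lattice: "complete_lattice (profinite_completion dia)"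
  (is "complete_lattice ?P")
proof (rule upper_semilattice.complete_lattice_if_directed_joins[OF prof_upper_semilattice])
  show "least ?P (prof_embed dia bot) (carrier ?P)"
    by (simp add: least_def prof_embed_bot_least prof_embed_carrier)
  show "\<exists>s. least ?P s (Upper ?P T)" if "directed ?P T" for T
    by (rule prof_directed_join[OF that]) (rule exI)
qed

lemma prof_embed_op:
  assumes "prof_op dia f (prof_embed dia a) (prof_embed dia b) \<in> prof_carrier dia"
  shows "prof_embed dia (f a b) = prof_op dia f (prof_embed dia a) (prof_embed dia b)"
proof (rule prof_eq_if_common[OF prof_embed_carrier assms])
  fix \<theta> assume \<theta>: "\<theta> \<in> fin_congs dia"
  have "f a b \<in> prof_op dia f (prof_embed dia a) (prof_embed dia b) \<theta>"
    by (rule prof_op_mem[OF \<theta>]) (rule prof_embed_mem[OF \<theta>])+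
  then show "prof_embed dia (f a b) \<theta> \<inter>
      prof_op dia f (prof_embed dia a) (prof_embed dia b) \<theta> \<noteq> {}"
    using prof_embed_mem[OF \<theta>] by blast
qed

lemma inj_prof_embed_iff: "inj (prof_embed dia) \<longleftrightarrow> residually_finite dia"
proof -
  have "prof_embed dia a = prof_embed dia b \<longleftrightarrow> (\<forall>\<theta>\<in>fin_congs dia. \<theta> `` {a} = \<theta> `` {b})" for a b
    by (metis prof_embed_apply prof_eqI[OF prof_embed_carrier prof_embed_carrier])
  then show ?thesis unfolding inj_def residually_finite_def by metis
qed

lemma completion_prof_embed_iff:
  "completion (prof_embed dia) (profinite_completion dia) \<longleftrightarrow> residually_finite dia"
proof -
  let ?\<mu> = "prof_embed dia" and ?P = "profinite_completion dia"
  have "?\<mu> (inf a b) = ?\<mu> a \<sqinter>\<^bsub>?P\<^esub> ?\<mu> b" "?\<mu> (sup a b) = ?\<mu> a \<squnion>\<^bsub>?P\<^esub> ?\<mu> b" for a b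
    using prof_embed_op[OF prof_inf_closed[OF prof_embed_carrier prof_embed_carrier]]
      prof_embed_op[OF prof_sup_closed[OF prof_embed_carrier prof_embed_carrier]]
    by (simp_all add: profinite_completion_ops prof_embed_carrier)
  then show ?thesis
    by (simp add: completion_def inj_prof_embed_iff prof_complete_lattice image_subset_iff
        prof_embed_carrier)
qed

section \<open>A join-dense embedding makes finite congruences principal\<close>

definition prof_compl ::
    "('a::boolean_algebra \<Rightarrow> 'a) \<Rightarrow> (('a \<times> 'a) set \<Rightarrow> 'a set) \<Rightarrow> ('a \<times> 'a) set \<Rightarrow> 'a set" where
  "prof_compl dia \<alpha> = prof_op dia (\<lambda>a _. - a) \<alpha> \<alpha>"

lemma prof_compl_closed:
  assumes "\<alpha> \<in> prof_carrier dia"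
  shows "prof_compl dia \<alpha> \<in> prof_carrier dia"
  unfolding prof_compl_def
  by (rule prof_op_closed[OF assms assms], rule quot_op_class)
    (simp_all add: fin_congs_equiv boolean_congruence.compl_cong[OF fin_congs_boolean_congruence])

lemma prof_compl_mem: "\<theta> \<in> fin_congs dia \<Longrightarrow> a \<in> \<alpha> \<theta> \<Longrightarrow> - a \<in> prof_compl dia \<alpha> \<theta>"
  unfolding prof_compl_def by (rule prof_op_mem)

lemma prof_compl_embed: "prof_compl dia (prof_embed dia a) = prof_embed dia (- a)"
proof (rule prof_eq_if_common[OF prof_compl_closed[OF prof_embed_carrier] prof_embed_carrier])
  fix \<theta> assume \<theta>: "\<theta> \<in> fin_congs dia"
  show "prof_compl dia (prof_embed dia a) \<theta> \<inter> prof_embed dia (- a) \<theta> \<noteq> {}"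
    using prof_compl_mem[OF \<theta>, of a "prof_embed dia a"] prof_embed_mem[OF \<theta>] by blast
qed

lemma prof_compl_antimono:
  assumes "\<alpha> \<in> prof_carrier dia" "\<beta> \<in> prof_carrier dia" and le: "\<alpha> \<sqsubseteq>\<^bsub>profinite_completion dia\<^esub> \<beta>"
  shows "prof_compl dia \<beta> \<sqsubseteq>\<^bsub>profinite_completion dia\<^esub> prof_compl dia \<alpha>"
  unfolding prof_le_iff[OF prof_compl_closed[OF assms(2)] prof_compl_closed[OF assms(1)]]
proof
  fix \<theta> assume \<theta>: "\<theta> \<in> fin_congs dia"
  then obtain a b where "a \<in> \<alpha> \<theta>" "b \<in> \<beta> \<theta>" "a \<le> b"
    using le assms by (auto simp: prof_le_iff class_le_def)
  then show "class_le (prof_compl dia \<beta> \<theta>) (prof_compl dia \<alpha> \<theta>)"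
    using prof_compl_mem[OF \<theta>] by (intro class_leI[of "- b" _ "- a"]) simp_all
qed

lemma prof_top_class_lower_bound:
  assumes \<theta>: "\<theta> \<in> fin_congs dia"
  obtains w where "w \<in> prof_carrier dia" and "w \<theta> = \<theta> `` {top}"
    and "\<And>b. (top, b) \<in> \<theta> \<Longrightarrow> w \<sqsubseteq>\<^bsub>profinite_completion dia\<^esub> prof_embed dia b"
proof -
  let ?P = "profinite_completion dia" and ?Z = "{a. (a, bot) \<in> \<theta>}"
  interpret boolean_congruence \<theta> using \<theta> by (rule fin_congs_boolean_congruence)
  have "directed ?P (prof_embed dia ` ?Z)"
  proof (rule prof_embed_directed)
    show "?Z \<noteq> {}" using refl by blast
    show "sup a b \<in> ?Z" if "a \<in> ?Z" "b \<in> ?Z" for a b using sup_cong[of a bot b bot] that by simp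
  qed
  then obtain v where v: "least ?P v (Upper ?P (prof_embed dia ` ?Z))"
    and attained: "\<And>\<psi>. \<psi> \<in> fin_congs dia \<Longrightarrow> \<exists>\<tau>\<in>prof_embed dia ` ?Z. v \<psi> = \<tau> \<psi>"
    by (rule prof_directed_join) blast
  have carrier: "v \<in> prof_carrier dia" using least_closed[OF v] by simp
  show thesis
  proof (rule that)
    show w: "prof_compl dia v \<in> prof_carrier dia" by (rule prof_compl_closed[OF carrier])
    have "bot \<in> v \<theta>" using attained[OF \<theta>] \<theta> by (auto simp: prof_embed_apply)
    then have "top \<in> prof_compl dia v \<theta>" using prof_compl_mem[OF \<theta>] by fastforce
    then show "prof_compl dia v \<theta> = \<theta> `` {top}" by (rule class_eqI[OF prof_class[OF w \<theta>]])
    fix b assume "(top, b) \<in> \<theta>"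
    then have "(- b, bot) \<in> \<theta>" using compl_cong[OF sym] by fastforce
    then have "prof_embed dia (- b) \<sqsubseteq>\<^bsub>?P\<^esub> v"
      using least_Upper_above[OF v, of "prof_embed dia (- b)"] prof_embed_carrier by auto
    then show "prof_compl dia v \<sqsubseteq>\<^bsub>?P\<^esub> prof_embed dia b"
      using prof_compl_antimono[OF prof_embed_carrier carrier]
      by (fastforce simp: prof_compl_embed)
  qed
qed

lemma macneille_prof_attained_below:
  assumes M: "macneille_completion (prof_embed dia) (profinite_completion dia)"
    and \<alpha>: "\<alpha> \<in> prof_carrier dia" and \<theta>: "\<theta> \<in> fin_congs dia"
  obtains a where "prof_embed dia a \<sqsubseteq>\<^bsub>profinite_completion dia\<^esub> \<alpha>" and "a \<in> \<alpha> \<theta>"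
proof -
  let ?\<mu> = "prof_embed dia" and ?P = "profinite_completion dia"
  let ?I = "{a. ?\<mu> a \<sqsubseteq>\<^bsub>?P\<^esub> \<alpha>}"
  interpret P: complete_lattice ?P by (rule prof_complete_lattice)
  have "directed ?P (?\<mu> ` ?I)"
  proof (rule prof_embed_directed)
    show "?I \<noteq> {}" using prof_embed_bot_least[OF \<alpha>] by blast
    show "sup a b \<in> ?I" if "a \<in> ?I" "b \<in> ?I" for a b
      using prof_sup_least[OF prof_embed_carrier prof_embed_carrier \<alpha>] that
      by (simp add: prof_embed_op prof_sup_closed prof_embed_carrier)
  qed
  then obtain s where s: "least ?P s (Upper ?P (?\<mu> ` ?I))"
    and attained: "\<And>\<psi>. \<psi> \<in> fin_congs dia \<Longrightarrow> \<exists>\<tau>\<in>?\<mu> ` ?I. s \<psi> = \<tau> \<psi>"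
    by (rule prof_directed_join) blast
  have "least ?P \<alpha> (Upper ?P (?\<mu> ` ?I))"
  proof (rule least_UpperI)
    fix \<beta> assume \<beta>: "\<beta> \<in> Upper ?P (?\<mu> ` ?I)"
    then have "?\<mu> a \<sqsubseteq>\<^bsub>?P\<^esub> \<beta>" if "?\<mu> a \<sqsubseteq>\<^bsub>?P\<^esub> \<alpha>" for a
      using that Upper_memD[OF \<beta>, of "?\<mu> a"] by (auto simp: prof_embed_carrier)
    then show "\<alpha> \<sqsubseteq>\<^bsub>?P\<^esub> \<beta>"
      using macneille_completion_join_dense[OF M] \<alpha> \<beta> by (simp add: Upper_def)
  qed (use \<alpha> prof_embed_carrier in auto)
  then have "s = \<alpha>" using s by (intro P.least_unique)
  then show thesis using attained[OF \<theta>] that prof_embed_mem[OF \<theta>] by auto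
qed

lemma fin_congs_principal_if_macneille:
  assumes M: "macneille_completion (prof_embed dia) (profinite_completion dia)"
    and \<theta>: "\<theta> \<in> fin_congs dia"
  shows "\<exists>a. \<theta> `` {top} = {b. b \<ge> a}"
proof -
  let ?\<mu> = "prof_embed dia" and ?P = "profinite_completion dia"
  interpret P: complete_lattice ?P by (rule prof_complete_lattice)
  interpret boolean_congruence \<theta> using \<theta> by (rule fin_congs_boolean_congruence)
  obtain w where w: "w \<in> prof_carrier dia" "w \<theta> = \<theta> `` {top}"
    and w_le: "\<And>b. (top, b) \<in> \<theta> \<Longrightarrow> w \<sqsubseteq>\<^bsub>?P\<^esub> ?\<mu> b"
    by (rule prof_top_class_lower_bound[OF \<theta>]) blast
  obtain a where a: "?\<mu> a \<sqsubseteq>\<^bsub>?P\<^esub> w" "(top, a) \<in> \<theta>"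
    using macneille_prof_attained_below[OF M w(1) \<theta>] w(2) by auto
  have "(top, b) \<in> \<theta> \<longleftrightarrow> a \<le> b" for b
  proof
    assume "(top, b) \<in> \<theta>"
    then have "?\<mu> a \<sqsubseteq>\<^bsub>?P\<^esub> ?\<mu> b"
      using P.le_trans[OF a(1) w_le] w(1) by (simp add: prof_embed_carrier)
    then show "a \<le> b" by (simp add: completion_le_iff[OF macneille_completionD[OF M]])
  next
    assume "a \<le> b"
    then show "(top, b) \<in> \<theta>" using sup_cong[OF a(2) refl[of b]] by (simp add: sup.absorb2)
  qed
  then show ?thesis by auto
qed

section \<open>Approximation modulo finite congruences\<close>

definition fin_cong_approximable ::
    "('a::boolean_algebra \<Rightarrow> 'a) \<Rightarrow> ('a \<Rightarrow> 'c) \<Rightarrow> 'c gorder \<Rightarrow> bool" where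
  "fin_cong_approximable dia m C \<longleftrightarrow> (\<forall>x\<in>carrier C. \<forall>\<theta>\<in>fin_congs dia.
     \<exists>a b. m a \<sqsubseteq>\<^bsub>C\<^esub> x \<and> x \<sqsubseteq>\<^bsub>C\<^esub> m b \<and> (a, b) \<in> \<theta>)"

lemma fin_cong_approximableE:
  assumes "fin_cong_approximable dia m C" "x \<in> carrier C" "\<theta> \<in> fin_congs dia"
  obtains a b where "m a \<sqsubseteq>\<^bsub>C\<^esub> x" and "x \<sqsubseteq>\<^bsub>C\<^esub> m b" and "(a, b) \<in> \<theta>"
  using assms unfolding fin_cong_approximable_def by blast

lemma fin_cong_approximable_iso:
  assumes approx: "fin_cong_approximable dia k D" and iso: "completion_iso k D m C"
  shows "fin_cong_approximable dia m C"
  unfolding fin_cong_approximable_def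
proof (intro ballI)
  fix x \<theta> assume x: "x \<in> carrier C" and \<theta>: "\<theta> \<in> fin_congs dia"
  obtain g where g: "bij_betw g (carrier D) (carrier C)" "\<And>a. g (k a) = m a"
    and le: "\<And>x y. x \<in> carrier D \<Longrightarrow> y \<in> carrier D \<Longrightarrow> g x \<sqsubseteq>\<^bsub>C\<^esub> g y \<longleftrightarrow> x \<sqsubseteq>\<^bsub>D\<^esub> y"
    using iso by (rule completion_isoE) blast
  have k: "k a \<in> carrier D" for a using iso completion_closed by (auto simp: completion_iso_def)
  obtain y where y: "y \<in> carrier D" "x = g y" using g(1) x by (auto simp: bij_betw_def)
  obtain a b where "k a \<sqsubseteq>\<^bsub>D\<^esub> y" "y \<sqsubseteq>\<^bsub>D\<^esub> k b" "(a, b) \<in> \<theta>"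
    using approx y(1) \<theta> by (rule fin_cong_approximableE)
  then show "\<exists>a b. m a \<sqsubseteq>\<^bsub>C\<^esub> x \<and> x \<sqsubseteq>\<^bsub>C\<^esub> m b \<and> (a, b) \<in> \<theta>"
    using le y k by (metis g(2))
qed

lemma prof_embed_bounds:
  assumes \<theta>: "\<theta> \<in> fin_congs dia" and p: "\<theta> `` {top} = {b. b \<ge> p}"
    and \<alpha>: "\<alpha> \<in> prof_carrier dia" and a: "a \<in> \<alpha> \<theta>"
  shows "prof_embed dia (inf a p) \<sqsubseteq>\<^bsub>profinite_completion dia\<^esub> \<alpha>"
    and "\<alpha> \<sqsubseteq>\<^bsub>profinite_completion dia\<^esub> prof_embed dia (sup a (- p))"
proof -
  interpret boolean_congruence \<theta> using \<theta> by (rule fin_congs_boolean_congruence)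
  have "class_le (prof_embed dia (inf a p) \<psi>) (\<alpha> \<psi>) \<and>
      class_le (\<alpha> \<psi>) (prof_embed dia (sup a (- p)) \<psi>)"
    if \<psi>: "\<psi> \<in> fin_congs dia" for \<psi>
  proof -
    obtain d where d: "d \<in> \<alpha> \<theta>" "d \<in> \<alpha> \<psi>" using prof_class_common[OF \<alpha> \<theta> \<psi>] by blast
    then have "(d, a) \<in> \<theta>" using in_quotient_imp_in_rel[OF equiv prof_class[OF \<alpha> \<theta>]] a by blast
    then have eq: "inf d p = inf a p" unfolding principal_iff[OF p] .
    have "inf a p \<le> d" using inf_le1[of d p] by (simp add: eq)
    moreover have "d \<le> sup a (- p)"
      using shunt1[of d p a] inf_le1[of a p] by (simp add: eq sup.commute)
    ultimately show ?thesis using d(2) prof_embed_mem[OF \<psi>] by (blast intro: class_leI)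
  qed
  then show "prof_embed dia (inf a p) \<sqsubseteq>\<^bsub>profinite_completion dia\<^esub> \<alpha>"
    and "\<alpha> \<sqsubseteq>\<^bsub>profinite_completion dia\<^esub> prof_embed dia (sup a (- p))"
    by (simp_all add: prof_le_iff \<alpha> prof_embed_carrier)
qed

lemma prof_fin_cong_approximable:
  assumes "\<forall>\<theta>\<in>fin_congs dia. \<exists>a. \<theta> `` {top} = {b. b \<ge> a}"
  shows "fin_cong_approximable dia (prof_embed dia) (profinite_completion dia)"
  unfolding fin_cong_approximable_def
proof (intro ballI)
  fix \<alpha> \<theta> assume "\<alpha> \<in> carrier (profinite_completion dia)" and \<theta>: "\<theta> \<in> fin_congs dia"
  then have \<alpha>: "\<alpha> \<in> prof_carrier dia" by simp
  interpret boolean_congruence \<theta> using \<theta> by (rule fin_congs_boolean_congruence)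
  obtain p where p: "\<theta> `` {top} = {b. b \<ge> p}" using assms \<theta> by blast
  obtain a where a: "a \<in> \<alpha> \<theta>" using prof_class_nonempty[OF \<alpha> \<theta>] by blast
  have "(inf a p, sup a (- p)) \<in> \<theta>"
    unfolding principal_iff[OF p] by (simp add: inf.assoc inf_sup_distrib2)
  then show "\<exists>a b. prof_embed dia a \<sqsubseteq>\<^bsub>profinite_completion dia\<^esub> \<alpha> \<and>
      \<alpha> \<sqsubseteq>\<^bsub>profinite_completion dia\<^esub> prof_embed dia b \<and> (a, b) \<in> \<theta>"
    using prof_embed_bounds[OF \<theta> p \<alpha> a] by blast
qed

lemma prof_le_if_approximated:
  assumes \<alpha>: "\<alpha> \<in> prof_carrier dia" and \<beta>: "\<beta> \<in> prof_carrier dia"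
    and approx: "\<And>\<theta>. \<theta> \<in> fin_congs dia \<Longrightarrow> \<exists>a b. prof_embed dia a \<sqsubseteq>\<^bsub>profinite_completion dia\<^esub> \<beta> \<and>
      \<alpha> \<sqsubseteq>\<^bsub>profinite_completion dia\<^esub> prof_embed dia b \<and> (a, b) \<in> \<theta>"
  shows "\<alpha> \<sqsubseteq>\<^bsub>profinite_completion dia\<^esub> \<beta>"
  unfolding prof_le_iff[OF \<alpha> \<beta>]
proof
  fix \<theta> assume \<theta>: "\<theta> \<in> fin_congs dia"
  interpret boolean_congruence \<theta> using \<theta> by (rule fin_congs_boolean_congruence)
  obtain a b where "prof_embed dia a \<sqsubseteq>\<^bsub>profinite_completion dia\<^esub> \<beta>"
    and "\<alpha> \<sqsubseteq>\<^bsub>profinite_completion dia\<^esub> prof_embed dia b" and "(a, b) \<in> \<theta>"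
    using approx[OF \<theta>] by blast
  then have "class_le (\<alpha> \<theta>) (\<theta> `` {b})" "class_le (\<theta> `` {b}) (\<beta> \<theta>)"
    using \<theta> class_eq_iff[of a b]
    by (auto simp: prof_le_iff \<alpha> \<beta> prof_embed_carrier prof_embed_apply)
  then show "class_le (\<alpha> \<theta>) (\<beta> \<theta>)"
    using class_le_trans[OF prof_class[OF \<alpha> \<theta>] quotientI[OF UNIV_I] prof_class[OF \<beta> \<theta>]] by blast
qed

lemma macneille_prof_if_approximable:
  assumes rf: "residually_finite dia"
    and approx: "fin_cong_approximable dia (prof_embed dia) (profinite_completion dia)"
  shows "macneille_completion (prof_embed dia) (profinite_completion dia)"
  unfolding macneille_completion_iff profinite_completion_simps
proof (intro conjI ballI impI)
  let ?P = "profinite_completion dia"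
  show "completion (prof_embed dia) ?P" using rf by (simp add: completion_prof_embed_iff)
  fix \<alpha> \<beta> assume \<alpha>: "\<alpha> \<in> prof_carrier dia" and \<beta>: "\<beta> \<in> prof_carrier dia"
  have bounds: "\<exists>a b. prof_embed dia a \<sqsubseteq>\<^bsub>?P\<^esub> \<alpha> \<and> \<alpha> \<sqsubseteq>\<^bsub>?P\<^esub> prof_embed dia b \<and> (a, b) \<in> \<theta>"
    if "\<theta> \<in> fin_congs dia" for \<theta>
    using approx \<alpha> that by (simp add: fin_cong_approximable_def)
  show "\<alpha> \<sqsubseteq>\<^bsub>?P\<^esub> \<beta>" if "\<forall>a. prof_embed dia a \<sqsubseteq>\<^bsub>?P\<^esub> \<alpha> \<longrightarrow> prof_embed dia a \<sqsubseteq>\<^bsub>?P\<^esub> \<beta>"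
    using bounds that by (intro prof_le_if_approximated[OF \<alpha> \<beta>]) blast
  show "\<beta> \<sqsubseteq>\<^bsub>?P\<^esub> \<alpha>" if "\<forall>a. \<alpha> \<sqsubseteq>\<^bsub>?P\<^esub> prof_embed dia a \<longrightarrow> \<beta> \<sqsubseteq>\<^bsub>?P\<^esub> prof_embed dia a"
    using bounds that by (intro prof_le_if_approximated[OF \<beta> \<alpha>]) blast
qed

section \<open>Smoothness\<close>

lemma lower_ext_le_upper_ext:
  assumes m: "completion m C" and "mono f" and x: "x \<in> carrier C"
  shows "lower_ext m C f x \<sqsubseteq>\<^bsub>C\<^esub> upper_ext m C f x"
proof -
  interpret complete_lattice C using m by (rule completion_complete_lattice)
  have m_closed: "m a \<in> carrier C" for a using m by (rule completion_closed)
  have "m (f a) \<sqsubseteq>\<^bsub>C\<^esub> m (f b)" if "m a \<sqsubseteq>\<^bsub>C\<^esub> x" "x \<sqsubseteq>\<^bsub>C\<^esub> m b" for a b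
    using le_trans[OF that] x m_closed \<open>mono f\<close>
    by (auto simp: completion_le_iff[OF m] dest: monoD)
  then show ?thesis
    unfolding lower_ext_def upper_ext_def
    by (intro sup_least inf_greatest inf_closed) (auto simp: m_closed)
qed

lemma smooth_if_approximable:
  assumes "mono dia" and M: "macneille_completion m C" and rf: "residually_finite dia"
    and approx: "fin_cong_approximable dia m C"
  shows "smooth m C dia"
  unfolding smooth_def
proof
  fix x assume x: "x \<in> carrier C"
  let ?l = "lower_ext m C dia x" and ?u = "upper_ext m C dia x"
  have m: "completion m C" using M by (rule macneille_completionD)
  interpret complete_lattice C using m by (rule completion_complete_lattice)
  have m_closed: "m a \<in> carrier C" for a using m by (rule completion_closed)
  have l: "?l \<in> carrier C" unfolding lower_ext_def by (rule sup_closed) (auto simp: m_closed)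
  have u: "?u \<in> carrier C" unfolding upper_ext_def by (rule inf_closed) (auto simp: m_closed)
  have l_upper: "m (dia a) \<sqsubseteq>\<^bsub>C\<^esub> ?l" if "m a \<sqsubseteq>\<^bsub>C\<^esub> x" for a
    unfolding lower_ext_def using that by (intro sup_upper) (auto simp: m_closed)
  have u_lower: "?u \<sqsubseteq>\<^bsub>C\<^esub> m (dia a)" if "x \<sqsubseteq>\<^bsub>C\<^esub> m a" for a
    unfolding upper_ext_def using that by (intro inf_lower) (auto simp: m_closed)
  have "?u \<sqsubseteq>\<^bsub>C\<^esub> ?l"
  proof (rule macneille_completion_leI[OF M u l], rule residually_finite_leI[OF rf])
    fix b c \<theta> assume b: "m b \<sqsubseteq>\<^bsub>C\<^esub> ?u" and c: "?l \<sqsubseteq>\<^bsub>C\<^esub> m c" and \<theta>: "\<theta> \<in> fin_congs dia"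
    interpret \<theta>: boolean_congruence \<theta> using \<theta> by (rule fin_congs_boolean_congruence)
    obtain e e' where e: "m e \<sqsubseteq>\<^bsub>C\<^esub> x" "x \<sqsubseteq>\<^bsub>C\<^esub> m e'" "(e, e') \<in> \<theta>"
      using approx x \<theta> by (rule fin_cong_approximableE)
    have "b \<le> dia e'"
      using le_trans[OF b u_lower[OF e(2)]] u m_closed by (simp add: completion_le_iff[OF m])
    moreover have "\<theta> `` {dia e'} = \<theta> `` {dia e}"
      unfolding \<theta>.class_eq_iff using fin_congs_dia[OF \<theta> e(3)] by (rule \<theta>.sym)
    moreover have "dia e \<le> c"
      using le_trans[OF l_upper[OF e(1)] c] l m_closed by (simp add: completion_le_iff[OF m])
    ultimately show "class_le (\<theta> `` {b}) (\<theta> `` {c})"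
      using \<theta>.class_le_trans[OF quotientI quotientI quotientI] \<theta>.class_le_of_le by (metis UNIV_I)
  qed
  then show "?l = ?u"
    using lower_ext_le_upper_ext[OF m \<open>mono dia\<close> x] l u by (blast intro: le_antisym)
qed

theorem theorem3p1:
  fixes dia :: "'a::boolean_algebra \<Rightarrow> 'a"
    and m :: "'a \<Rightarrow> 'c" and C :: "'c gorder"
  assumes "modal_algebra dia"
    and "macneille_completion m C"
  shows "(completion_iso (prof_embed dia) (profinite_completion dia) m C \<and> smooth m C dia)
    \<longleftrightarrow> (residually_finite dia \<and>
         (\<forall>\<theta>\<in>fin_congs dia. \<exists>a. \<theta> `` {top} = {b. b \<ge> a}))"
proof (intro iffI; elim conjE)
  assume iso: "completion_iso (prof_embed dia) (profinite_completion dia) m C"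
  then have M: "macneille_completion (prof_embed dia) (profinite_completion dia)"
    using assms(2) by (rule macneille_completion_iso)
  have "residually_finite dia"
    using macneille_completionD[OF M] by (simp only: completion_prof_embed_iff)
  then show "residually_finite dia \<and> (\<forall>\<theta>\<in>fin_congs dia. \<exists>a. \<theta> `` {top} = {b. b \<ge> a})"
    using fin_congs_principal_if_macneille[OF M] by blast
next
  assume rf: "residually_finite dia"
    and principal: "\<forall>\<theta>\<in>fin_congs dia. \<exists>a. \<theta> `` {top} = {b. b \<ge> a}"
  have approx: "fin_cong_approximable dia (prof_embed dia) (profinite_completion dia)"
    using principal by (rule prof_fin_cong_approximable)
  have iso: "completion_iso (prof_embed dia) (profinite_completion dia) m C"
    using macneille_prof_if_approximable[OF rf approx] assms(2)
    by (rule macneille_completion_unique)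
  moreover have "smooth m C dia"
    using modal_algebra.mono_dia[OF assms(1)] assms(2) rf fin_cong_approximable_iso[OF approx iso]
    by (rule smooth_if_approximable)
  ultimately show "completion_iso (prof_embed dia) (profinite_completion dia) m C \<and>
    smooth m C dia" ..
qed

end
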